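(* Let $\Omega\subset\mathbb{R}^d$ be open, $p\in[1,+\infty)$, and let $(\mu_n)_{n\in\mathbb{N}_\infty}$ be Borel probability measures on $\Omega$ with finite $\max(2,p)$-th moment such that $\mu_n\to\mu_\infty$ in the $\max(2,p)$-Wasserstein metric as $n\to\infty$. Write $X_n:=L^p(\Omega;\mu_n)$ with norm $\|\cdot\|_n$. Let $(\Phi_n)_{n\in\mathbb{N}_{\infty}}$ be functionals $\Phi_n:\mathfrak{F}(\Omega;\mu_n)\to(-\infty,+\infty]$ such that: (i) for all $(u_n)_{n\in \mathbb{N}_\infty}$ with $u_n\in X_n$ and $(u_n,\mu_n)\to(u_\infty,\mu_\infty)$ in $TL^p(\Omega)$, $\liminf_{n\rightarrow \infty} \Phi_n(u_n) \geq \Phi_{\infty}(u_{\infty})$; (ii) for all $u_{\infty} \in L^{\max (2,p)}(\Omega;\mu_{\infty})$ there are $u_n\in L^{\max (2,p)}(\Omega;\mu_n)$ ($n\in\mathbb{N}$) with $(u_n,\mu_n)\to(u_\infty,\mu_\infty)$ in $TL^{\max(2,p)}(\Omega)$ and $\limsup_{n\rightarrow \infty} \Phi_n(u_n) \leq \Phi_{\infty}(u_{\infty})$; (iii) for all $(x_n)_{n\in \mathbb{N}}$ with $x_n\in X_n$ for which $(\Vert x_n \Vert_n)_{n\in \mathbb{N}}$ and $(\Phi_n(x_n))_{n\in \mathbb{N}}$ are bounded, there exist an $x_\infty \in X_\infty$ and a subsequence $\big((x_{n_k},\mu_{n_k})\big)_{k\in\mathbb{N}}$ that converges to $(x_\infty,\mu_\infty)$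 in $TL^p(\Omega)$; (iv) for all $n\in \mathbb{N}_\infty$, $\Phi_n$ is non-negative; (v) for all $\lambda>0$ there exists a strictly increasing function $f:[0,+\infty) \rightarrow [0,+\infty)$ with $f(0)=0$ and $f(r)\rightarrow+\infty$ as $r\rightarrow \infty$, such that for all $n \in \mathbb{N}$ and all $u\in X_n$, $\frac12\int_\Omega|u|^2\,d\mu_n+\lambda\Phi_n(u) \geq f(\Vert u \Vert_n )$. Then for all $(h_n)_{n\in \mathbb{N}_\infty}$ with $h_n\in L^2(\Omega;\mu_n)$ and $(h_n,\mu_n)\to(h_\infty,\mu_\infty)$ in $TL^2(\Omega)$ as $n\rightarrow \infty$, and for all $\lambda>0$: (a) $(\mathfrak{M}[\lambda,h_n;\Phi_n])_{n\in \mathbb{N}}$ $\Gamma$-converges to $\mathfrak{M}[\lambda,h_{\infty};\Phi_{\infty}]$ over $TL^p$ as $n\rightarrow \infty$; and (b) $\big( \mathfrak{M}[\lambda,h_n;\Phi_n] \big)_{n\in \mathbb{N}}$ is equicoercive over $TL^p$. In particular, $\mathcal{A}:=L^{\max(2,p)}(\Omega;\mu_{\infty})$ is dense in $X_\infty$ and, for all $\lambda>0$, all $h_\infty\in\mathcal{A}$, and all $(h_n)_{n\in\mathbb{N}}$ with $h_n\in L^{\max(2,p)}(\Omega;\mu_n)$ and $(h_n,\mu_n)\to(h_\infty,\mu_\infty)$ in $TL^{\max(2,p)}(\Omega)$, the conclusions (a) and (b) hold.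
   Context: $\mathbb{N}=\{1,2,\dots\}$, $\mathbb{N}_\infty=\mathbb{N}\cup\{\infty\}$. $\mathfrak{F}(\Omega;\mu)$ is the vector space of real-valued Borel-measurable functions on $\Omega$ modulo equality $\mu$-a.e. Transport metrics: $\Gamma(\mu,\nu)$ is the set of probability measures on $\Omega\times\Omega$ with marginals $\mu,\nu$. For $r\in[1,\infty)$, $\mathcal{P}_r(\Omega)$ is the set of Borel probability measures with finite $r$-th moment, with $r$-Wasserstein metric $d_r(\mu,\nu)=\inf_{\pi\in\Gamma(\mu,\nu)}\left(\int|x-y|^r\,d\pi\right)^{1/r}$. $TL^r(\Omega)$ is the set of pairs $(u,\mu)$ with $\mu\in\mathcal{P}_r(\Omega)$, $u\in L^r(\Omega;\mu)$, with metric $d_{TL^r}((u,\mu),(v,\nu))=\inf_{\pi\in\Gamma(\mu,\nu)}\left(\int_{\Omega\times\Omega}|u(x)-v(y)|^r+|x-y|^r\,d\pi(x,y)\right)^{1/r}$. For $\lambda>0$ and $h\in\mathfrak{F}(\Omega;\mu_n)$, $\mathfrak{M}[\lambda,h;\Phi_n](u):=\frac12\int_\Omega|u-h|^2\,d\mu_n+\lambda\Phi_n(u)\in(-\infty,+\infty]$ for $u\in\mathfrak{F}(\Omega;\mu_n)$; integrals may be $+\infty$. $\Gamma$-convergence over $TL^p$ of functionals $(\Psi_n)_{n\in\mathbb{N}}$ to $\Psi_\infty$ (considered on $X_n=L^p(\Omega;\mu_n)$): for all $v_n\in X_n$ ($n\in\mathbb{N}_\infty$) with $(v_n,\mu_n)\to(v_\infty,\mu_\infty)$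 in $TL^p(\Omega)$, $\liminf_n\Psi_n(v_n)\ge\Psi_\infty(v_\infty)$; and for every $v_\infty\in X_\infty$ there are $v_n\in X_n$ with $(v_n,\mu_n)\to(v_\infty,\mu_\infty)$ in $TL^p(\Omega)$ and $\limsup_n\Psi_n(v_n)\le\Psi_\infty(v_\infty)$. Equicoercivity over $TL^p$ of $(\Psi_n)_{n\in\mathbb{N}}$: for every $c\in\mathbb{R}$ and all $(v_n)_{n\in\mathbb{N}}$ with $v_n\in X_n$ and $\Psi_n(v_n)\le c$ for all $n\in\mathbb{N}$, there are $v_\infty\in X_\infty$ and a subsequence with $(v_{n_k},\mu_{n_k})\to(v_\infty,\mu_\infty)$ in $TL^p(\Omega)$ as $k\to\infty$. *)

theory Defs
  imports "HOL-Probability.Probability" "HOL-Library.Extended_Nat"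
begin

text \<open>
  Families over $\mathbb{N}_\infty = \mathbb{N} \cup \{\infty\}$ are functions on \<^typ>\<open>enat\<close>:
  the terms of the sequence sit at \<open>enat n\<close>, the limit object at \<open>\<infinity>\<close>.
  A Borel measure on an open set \<open>\<Omega>\<close> is a measure on \<open>restrict_space borel \<Omega>\<close>.
  Elements of $\mathfrak{F}(\Omega;\mu)$ and of the Lebesgue spaces are given by representatives;
  functionals on classes are functions on representatives that respect equality a.e.
\<close>

definition prob_moment :: "(real ^ 'd) set \<Rightarrow> real \<Rightarrow> (real ^ 'd) measure set" where
  "prob_moment \<Omega> r =
    {\<mu>. prob_space \<mu> \<and> sets \<mu> = sets (restrict_space borel \<Omega>) \<and>
        integrable \<mu> (\<lambda>x. norm x powr r)}"

definition couplings :: "(real ^ 'd) measure \<Rightarrow> (real ^ 'd) measure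
    \<Rightarrow> ((real ^ 'd) \<times> (real ^ 'd)) measure set" where
  "couplings \<mu> \<nu> =
    {\<pi>. prob_space \<pi> \<and> sets \<pi> = sets (\<mu> \<Otimes>\<^sub>M \<nu>) \<and>
        distr \<pi> \<mu> fst = \<mu> \<and> distr \<pi> \<nu> snd = \<nu>}"

text \<open>
  In the two transport distances the integrand is integrable for every coupling, and the set of
  couplings is nonempty, as long as the arguments lie in \<open>prob_moment \<Omega> r\<close>, resp. in the set
  \<open>TL \<Omega> r\<close> defined below; the real-valued integral and infimum are only used there.
\<close>

definition wasserstein :: "real \<Rightarrow> (real ^ 'd) measure \<Rightarrow> (real ^ 'd) measure \<Rightarrow> real" where
  "wasserstein r \<mu> \<nu> =
    (INF \<pi>\<in>couplings \<mu> \<nu>. (\<integral>z. norm (fst z - snd z) powr r \<partial>\<pi>) powr (1 / r))"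

definition Lp_space :: "real \<Rightarrow> 'a measure \<Rightarrow> ('a \<Rightarrow> real) set" where
  "Lp_space r \<mu> = {u \<in> borel_measurable \<mu>. integrable \<mu> (\<lambda>x. \<bar>u x\<bar> powr r)}"

definition Lp_norm :: "real \<Rightarrow> 'a measure \<Rightarrow> ('a \<Rightarrow> real) \<Rightarrow> real" where
  "Lp_norm r \<mu> u = (\<integral>x. \<bar>u x\<bar> powr r \<partial>\<mu>) powr (1 / r)"

definition Lp_dense :: "real \<Rightarrow> 'a measure \<Rightarrow> ('a \<Rightarrow> real) set \<Rightarrow> bool" where
  "Lp_dense r \<mu> A \<longleftrightarrow>
    A \<subseteq> Lp_space r \<mu> \<and>
    (\<forall>u\<in>Lp_space r \<mu>. \<forall>e>0. \<exists>a\<in>A. Lp_norm r \<mu> (\<lambda>x. u x - a x) < e)"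

definition TL :: "(real ^ 'd) set \<Rightarrow> real \<Rightarrow> ((real ^ 'd \<Rightarrow> real) \<times> (real ^ 'd) measure) set" where
  "TL \<Omega> r = {(u, \<mu>). \<mu> \<in> prob_moment \<Omega> r \<and> u \<in> Lp_space r \<mu>}"

definition TL_dist :: "real \<Rightarrow> (real ^ 'd \<Rightarrow> real) \<times> (real ^ 'd) measure
    \<Rightarrow> (real ^ 'd \<Rightarrow> real) \<times> (real ^ 'd) measure \<Rightarrow> real" where
  "TL_dist r a b =
    (INF \<pi>\<in>couplings (snd a) (snd b).
      (\<integral>z. \<bar>fst a (fst z) - fst b (snd z)\<bar> powr r + norm (fst z - snd z) powr r \<partial>\<pi>) powr (1 / r))"

definition TL_converges :: "(real ^ 'd) set \<Rightarrow> real
    \<Rightarrow> (nat \<Rightarrow> (real ^ 'd \<Rightarrow> real) \<times> (real ^ 'd) measure)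
    \<Rightarrow> (real ^ 'd \<Rightarrow> real) \<times> (real ^ 'd) measure \<Rightarrow> bool" where
  "TL_converges \<Omega> r a b \<longleftrightarrow>
    (\<forall>n. a n \<in> TL \<Omega> r) \<and> b \<in> TL \<Omega> r \<and> (\<lambda>n. TL_dist r (a n) b) \<longlonglongrightarrow> 0"

definition ae_functional :: "'a measure \<Rightarrow> (('a \<Rightarrow> real) \<Rightarrow> ereal) \<Rightarrow> bool" where
  "ae_functional \<mu> \<Phi> \<longleftrightarrow>
    (\<forall>u\<in>borel_measurable \<mu>. \<Phi> u \<noteq> -\<infinity>) \<and>
    (\<forall>u\<in>borel_measurable \<mu>. \<forall>v\<in>borel_measurable \<mu>. (AE x in \<mu>. u x = v x) \<longrightarrow> \<Phi> u = \<Phi> v)"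

definition half_sq_integral :: "'a measure \<Rightarrow> ('a \<Rightarrow> real) \<Rightarrow> ereal" where
  "half_sq_integral \<mu> w = ereal (1 / 2) * enn2ereal (\<integral>\<^sup>+ x. ennreal (\<bar>w x\<bar>\<^sup>2) \<partial>\<mu>)"

definition M_functional :: "'a measure \<Rightarrow> real \<Rightarrow> ('a \<Rightarrow> real) \<Rightarrow> (('a \<Rightarrow> real) \<Rightarrow> ereal)
    \<Rightarrow> ('a \<Rightarrow> real) \<Rightarrow> ereal" where
  "M_functional \<mu> lam h \<Phi> u = half_sq_integral \<mu> (\<lambda>x. u x - h x) + ereal lam * \<Phi> u"

definition Gamma_converges :: "(real ^ 'd) set \<Rightarrow> real \<Rightarrow> (enat \<Rightarrow> (real ^ 'd) measure)
    \<Rightarrow> (enat \<Rightarrow> (real ^ 'd \<Rightarrow> real) \<Rightarrow> ereal) \<Rightarrow> bool" where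
  "Gamma_converges \<Omega> p \<mu> \<Psi> \<longleftrightarrow>
    (\<forall>v. (\<forall>n. v n \<in> Lp_space p (\<mu> n)) \<and>
         TL_converges \<Omega> p (\<lambda>n. (v (enat n), \<mu> (enat n))) (v \<infinity>, \<mu> \<infinity>) \<longrightarrow>
         liminf (\<lambda>n. \<Psi> (enat n) (v (enat n))) \<ge> \<Psi> \<infinity> (v \<infinity>)) \<and>
    (\<forall>w\<in>Lp_space p (\<mu> \<infinity>). \<exists>v. (\<forall>n. v n \<in> Lp_space p (\<mu> (enat n))) \<and>
         TL_converges \<Omega> p (\<lambda>n. (v n, \<mu> (enat n))) (w, \<mu> \<infinity>) \<and>
         limsup (\<lambda>n. \<Psi> (enat n) (v n)) \<le> \<Psi> \<infinity> w)"

text \<open>The value \<open>\<Psi> \<infinity>\<close> plays no role in equicoercivity.\<close>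

definition equicoercive :: "(real ^ 'd) set \<Rightarrow> real \<Rightarrow> (enat \<Rightarrow> (real ^ 'd) measure)
    \<Rightarrow> (enat \<Rightarrow> (real ^ 'd \<Rightarrow> real) \<Rightarrow> ereal) \<Rightarrow> bool" where
  "equicoercive \<Omega> p \<mu> \<Psi> \<longleftrightarrow>
    (\<forall>c::real. \<forall>v. (\<forall>n. v n \<in> Lp_space p (\<mu> (enat n)) \<and> \<Psi> (enat n) (v n) \<le> ereal c) \<longrightarrow>
      (\<exists>w\<in>Lp_space p (\<mu> \<infinity>). \<exists>s. strict_mono s \<and>
         TL_converges \<Omega> p (\<lambda>k. (v (s k), \<mu> (enat (s k)))) (w, \<mu> \<infinity>)))"

end

theory Submission
  imports Defs
begin

text \<open>
  Convergence in $TL^r$ is witnessed by couplings whose transport cost tends to $0$, and then any other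
  couplings with vanishing transport cost witness it as well; hence $u_n$ and $h_n$ may be compared
  along one and the same sequence of couplings. Along it, $\int |u_n - h_n|^2$ is lower
  semicontinuous under $L^1$-convergence (truncate the limit) and upper semicontinuous
  under $L^2$-convergence, which combines with (i) and (ii). A function at which the limit functional is
  finite automatically lies in $L^2$, so (ii) provides its recovery sequence; elsewhere any
  approximating sequence does. Equicoercivity follows from the bounds that a bounded value of the
  functional imposes on the norm, through (v), and on $\Phi_n$.
\<close>

text \<open>The obstacle is a mismatch of exponents. For p < 2 a sequence that converges in TL^p
  need not converge in L^2 along any couplings, so the quadratic term is not continuous along the
  sequences that Gamma-convergence admits. L^1 is the exponent that serves u_n and h_n alike for
  every p, and it yields only the lower bound; the upper bound needs L^2, which is why recovery
  sequences are taken in TL^max(2,p). Couplings can be exchanged because of the bounded Lipschitz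
  functions g: they are dense in L^r of the limit measure, and g(x) - g(y) is small in every L^r
  along any couplings for which the first moment of |x - y| vanishes. Most estimates concern r-th
  moments in \<open>ennreal\<close>, without the r-th root. The triangle inequality then costs a
  factor 2^r, which is harmless wherever only convergence to 0 or finiteness is at stake, and no
  integrability has to be carried along.\<close>

section \<open>Null sequences in \<open>ennreal\<close> and elementary inequalities for
  powers\<close>

lemma ennreal_tendsto_0I:
  fixes f :: "nat \<Rightarrow> ennreal"
  assumes "\<And>e::real. e > 0 \<Longrightarrow> \<forall>\<^sub>F n in sequentially. f n \<le> ennreal e"
  shows "f \<longlonglongrightarrow> 0"
proof (rule order_tendstoI)
  fix a :: ennreal assume "0 < a"
  then obtain b where b: "0 < b" "b < a" using dense by blast
  then obtain e where e: "0 < e" "ennreal e < a"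
    by (cases b) (auto simp: ennreal_less_zero_iff)
  show "\<forall>\<^sub>F n in sequentially. f n < a"
    using assms[OF e(1)] by eventually_elim (use e in \<open>simp add: order_le_less_trans\<close>)
qed simp

lemma ennreal_tendsto_0D:
  fixes f :: "nat \<Rightarrow> ennreal"
  assumes "f \<longlonglongrightarrow> 0" "e > 0"
  shows "\<forall>\<^sub>F n in sequentially. f n < ennreal e"
  using assms order_tendstoD(2)[of f 0 sequentially "ennreal e"] by simp

text \<open>The shape of every approximation argument below: a fixed error \<open>e\<close> from the
  approximation, plus a null sequence that may depend on the approximant and hence on
  \<open>e\<close>.\<close>

lemma ennreal_tendsto_0_leI:
  fixes f :: "nat \<Rightarrow> ennreal"
  assumes "\<And>e::real. e > 0 \<Longrightarrow> \<exists>g. g \<longlonglongrightarrow> 0 \<and> (\<forall>n. f n \<le> ennreal e + g n)"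
  shows "f \<longlonglongrightarrow> 0"
proof (rule ennreal_tendsto_0I)
  fix e :: real assume e: "e > 0"
  then obtain g where g: "g \<longlonglongrightarrow> 0" "\<And>n. f n \<le> ennreal (e/2) + g n"
    using assms[of "e/2"] by auto
  have "\<forall>\<^sub>F n in sequentially. g n < ennreal (e / 2)"
    using g e by (intro ennreal_tendsto_0D) auto
  then show "\<forall>\<^sub>F n in sequentially. f n \<le> ennreal e"
  proof eventually_elim
    fix n assume "g n < ennreal (e / 2)"
    then have "f n \<le> ennreal (e/2) + ennreal (e/2)"
      using g(2)[of n] by (meson add_left_mono less_imp_le order_trans)
    then show "f n \<le> ennreal e" using e by (simp flip: ennreal_plus)
  qed
qed

lemma ennreal_cmult_tendsto_0:
  fixes f :: "nat \<Rightarrow> ennreal"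
  assumes "f \<longlonglongrightarrow> 0"
  shows "(\<lambda>n. ennreal c * f n) \<longlonglongrightarrow> 0"
  using ennreal_tendsto_cmult[of "ennreal c" f 0 sequentially] assms by simp

lemma minus_ennreal_le_iff: "a - ennreal e \<le> b \<longleftrightarrow> a \<le> b + ennreal e"
  by (simp add: ennreal_minus_le_iff add.commute[of b])

lemma nonneg_imp_no_opposite_infinities:
  fixes a b :: ereal
  assumes "0 \<le> a" "0 \<le> b"
  shows "\<not> (a = \<infinity> \<and> b = -\<infinity> \<or> a = -\<infinity> \<and> b = \<infinity>)"
  using assms by auto

text \<open>The sum is at most twice the larger term. The constant is crude, but it is valid for
  every \<open>r \<ge> 0\<close> alike.\<close>

lemma abs_powr_le_add:
  fixes a b c :: real
  assumes "0 \<le> r" "\<bar>c\<bar> \<le> \<bar>a\<bar> + \<bar>b\<bar>"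
  shows "\<bar>c\<bar> powr r \<le> 2 powr r * (\<bar>a\<bar> powr r + \<bar>b\<bar> powr r)"
proof -
  have "\<bar>c\<bar> powr r \<le> (2 * max \<bar>a\<bar> \<bar>b\<bar>) powr r"
    using assms by (intro powr_mono2) auto
  also have "\<dots> = 2 powr r * max \<bar>a\<bar> \<bar>b\<bar> powr r" by (simp add: powr_mult)
  also have "\<dots> \<le> 2 powr r * (\<bar>a\<bar> powr r + \<bar>b\<bar> powr r)"
    by (intro mult_left_mono) (auto simp: max_def)
  finally show ?thesis .
qed

text \<open>Up to the threshold \<open>e\<close> the first term dominates; beyond it
  \<open>t powr (p - q)\<close> is at most \<open>e powr (p - q)\<close>, the exponent being
  non-positive. A small \<open>e\<close> makes the constant term small at the price of a large
  factor before the higher power.\<close>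

lemma powr_le_powr_add:
  fixes t :: real
  assumes "0 \<le> t" "0 < p" "p \<le> q" "0 < e"
  shows "t powr p \<le> e powr p + e powr (p - q) * t powr q"
proof (cases "t \<le> e")
  case True
  then have "t powr p \<le> e powr p" using assms by (intro powr_mono2) auto
  then show ?thesis by (simp add: add_increasing2)
next
  case False
  then have "t powr p = t powr (p - q) * t powr q"
    using assms by (simp flip: powr_add)
  also have "\<dots> \<le> e powr (p - q) * t powr q"
    using assms False by (intro mult_right_mono powr_mono2') auto
  finally show ?thesis by (simp add: add_increasing)
qed

section \<open>Absolute moments and Lebesgue spaces\<close>

text \<open>Valued in \<open>ennreal\<close> and without the r-th root: functions with infinite
  moment are covered, and linearity of the integral applies directly.\<close>

definition abs_moment :: "real \<Rightarrow> 'a measure \<Rightarrow> ('a \<Rightarrow> real) \<Rightarrow> ennreal" where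
  "abs_moment r M f = (\<integral>\<^sup>+x. ennreal (\<bar>f x\<bar> powr r) \<partial>M)"

lemma abs_moment_mono:
  assumes "0 \<le> r" "\<And>x. x \<in> space M \<Longrightarrow> \<bar>f x\<bar> \<le> \<bar>g x\<bar>"
  shows "abs_moment r M f \<le> abs_moment r M g"
  unfolding abs_moment_def using assms
  by (intro nn_integral_mono ennreal_leI powr_mono2) auto

lemma abs_moment_cong:
  "(\<And>x. x \<in> space M \<Longrightarrow> \<bar>f x\<bar> = \<bar>g x\<bar>) \<Longrightarrow> abs_moment r M f = abs_moment r M g"
  unfolding abs_moment_def by (intro nn_integral_cong) simp

text \<open>The triangle inequality for moments, phrased by domination so that it serves sums and
  differences in any arrangement of signs.\<close>

lemma abs_moment_add_le:
  assumes [measurable]: "f \<in> borel_measurable M" "g \<in> borel_measurable M"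
    and "0 \<le> r" "\<And>x. x \<in> space M \<Longrightarrow> \<bar>h x\<bar> \<le> \<bar>f x\<bar> + \<bar>g x\<bar>"
  shows "abs_moment r M h \<le> ennreal (2 powr r) * (abs_moment r M f + abs_moment r M g)"
proof -
  have "abs_moment r M h \<le> (\<integral>\<^sup>+x. ennreal (2 powr r) * (ennreal (\<bar>f x\<bar> powr r) + ennreal (\<bar>g x\<bar> powr r)) \<partial>M)"
    unfolding abs_moment_def
  proof (rule nn_integral_mono)
    fix x assume "x \<in> space M"
    from abs_powr_le_add[OF assms(3) assms(4)[OF this]]
    show "ennreal (\<bar>h x\<bar> powr r) \<le> ennreal (2 powr r) * (ennreal (\<bar>f x\<bar> powr r) + ennreal (\<bar>g x\<bar> powr r))"
      by (simp add: ennreal_leI flip: ennreal_plus ennreal_mult)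
  qed
  also have "\<dots> = ennreal (2 powr r) * (abs_moment r M f + abs_moment r M g)"
    unfolding abs_moment_def by (simp add: nn_integral_cmult nn_integral_add)
  finally show ?thesis .
qed

text \<open>Total mass 1 turns the constant term of the pointwise inequality into itself. Unlike
  Jensen's inequality this is linear in the higher moment: \<open>e = 1\<close> transfers
  finiteness, a small \<open>e\<close> transfers convergence to 0.\<close>

lemma abs_moment_le_higher:
  assumes "prob_space M" and [measurable]: "f \<in> borel_measurable M"
    and "0 < p" "p \<le> q" "0 < e"
  shows "abs_moment p M f \<le> ennreal (e powr p) + ennreal (e powr (p - q)) * abs_moment q M f"
proof -
  interpret prob_space M by fact
  have "abs_moment p M f \<le> (\<integral>\<^sup>+x. ennreal (e powr p) + ennreal (e powr (p - q)) * ennreal (\<bar>f x\<bar> powr q) \<partial>M)"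
    unfolding abs_moment_def using assms powr_le_powr_add[OF abs_ge_zero assms(3-5)]
    by (intro nn_integral_mono) (simp add: ennreal_leI flip: ennreal_plus ennreal_mult)
  also have "\<dots> = ennreal (e powr p) + ennreal (e powr (p - q)) * abs_moment q M f"
    unfolding abs_moment_def by (simp add: nn_integral_cmult nn_integral_add emeasure_space_1)
  finally show ?thesis .
qed

lemma abs_moment_finite_lower:
  assumes "prob_space M" "f \<in> borel_measurable M" "0 < p" "p \<le> q" "abs_moment q M f < \<infinity>"
  shows "abs_moment p M f < \<infinity>"
  using abs_moment_le_higher[OF assms(1-4), of 1] assms(5)
  by (auto simp: order_le_less_trans)

lemma abs_moment_tendsto_lower:
  assumes "\<And>n::nat. prob_space (M n)" "\<And>n. f n \<in> borel_measurable (M n)" "0 < p" "p \<le> q"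
    and "(\<lambda>n. abs_moment q (M n) (f n)) \<longlonglongrightarrow> 0"
  shows "(\<lambda>n. abs_moment p (M n) (f n)) \<longlonglongrightarrow> 0"
proof (rule ennreal_tendsto_0_leI)
  fix e :: real assume e: "e > 0"
  \<comment> \<open>Chosen so that the constant term \<open>?d powr p\<close> is exactly
    \<open>e\<close>.\<close>
  let ?d = "e powr (1/p)"
  have "?d powr p = e" using e assms(3) by (simp add: powr_powr)
  then have "abs_moment p (M n) (f n) \<le> ennreal e + ennreal (?d powr (p - q)) * abs_moment q (M n) (f n)" for n
    using abs_moment_le_higher[OF assms(1,2,3,4), of ?d n] e by simp
  then show "\<exists>g. g \<longlonglongrightarrow> 0 \<and> (\<forall>n. abs_moment p (M n) (f n) \<le> ennreal e + g n)"
    using ennreal_cmult_tendsto_0[OF assms(5)] by blast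
qed

lemma integrable_abs_powr_iff:
  assumes "f \<in> borel_measurable M"
  shows "integrable M (\<lambda>x. \<bar>f x\<bar> powr r) \<longleftrightarrow> abs_moment r M f < \<infinity>"
  using assms unfolding abs_moment_def integrable_iff_bounded by simp

lemma Lp_space_iff: "u \<in> Lp_space r M \<longleftrightarrow> u \<in> borel_measurable M \<and> abs_moment r M u < \<infinity>"
  unfolding Lp_space_def using integrable_abs_powr_iff by blast

lemma abs_moment_eq_integral:
  assumes "f \<in> borel_measurable M" "abs_moment r M f < \<infinity>"
  shows "abs_moment r M f = ennreal (\<integral>x. \<bar>f x\<bar> powr r \<partial>M)"
  using assms integrable_abs_powr_iff[of f M r] unfolding abs_moment_def
  by (simp add: nn_integral_eq_integral)

lemma Lp_space_mono:
  assumes "prob_space M" "0 < p" "p \<le> q"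
  shows "Lp_space q M \<subseteq> Lp_space p M"
  using abs_moment_finite_lower[OF assms(1) _ assms(2,3)] by (auto simp: Lp_space_iff)

lemma Lp_space_max:
  assumes "u \<in> Lp_space p M" "u \<in> Lp_space q M"
  shows "u \<in> Lp_space (max p q) M"
  using assms by (auto simp: max_def)

lemma Lp_space_bounded:
  assumes "prob_space M" "g \<in> borel_measurable M" "\<And>x. \<bar>g x\<bar> \<le> B" "0 \<le> r"
  shows "g \<in> Lp_space r M"
proof -
  interpret prob_space M by fact
  have "abs_moment r M g \<le> abs_moment r M (\<lambda>_. B)"
    using assms by (intro abs_moment_mono) (force intro: order_trans)+
  also have "\<dots> < \<infinity>" unfolding abs_moment_def by (simp add: emeasure_space_1)
  finally show ?thesis using assms by (simp add: Lp_space_iff)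
qed

section \<open>Density of bounded Lipschitz functions\<close>

text \<open>Functions on the whole space and not on \<open>\<Omega>\<close>, so that one
  \<open>g\<close> is measurable for all measures of a family at once. Boundedness puts
  \<open>g\<close> into every L^r and, with the Lipschitz constant, bounds each power of
  \<open>g x - g y\<close> by a multiple of the distance.\<close>

definition bounded_lipschitz :: "('a::metric_space \<Rightarrow> real) set" where
  "bounded_lipschitz = {g. (\<exists>B. \<forall>x. \<bar>g x\<bar> \<le> B) \<and> (\<exists>L. L-lipschitz_on UNIV g)}"

definition clamp_abs :: "real \<Rightarrow> real \<Rightarrow> real" where
  "clamp_abs k t = max (-k) (min k t)"

lemma clamp_abs_dist: "\<bar>clamp_abs k s - clamp_abs k t\<bar> \<le> \<bar>s - t\<bar>"
  unfolding clamp_abs_def by (auto simp: max_def min_def)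

lemma abs_clamp_abs: "0 \<le> k \<Longrightarrow> \<bar>clamp_abs k t\<bar> \<le> k"
  unfolding clamp_abs_def by (auto simp: max_def min_def)

lemma clamp_abs_id: "\<bar>t\<bar> \<le> k \<Longrightarrow> clamp_abs k t = t"
  unfolding clamp_abs_def by (auto simp: max_def min_def)

lemma borel_measurable_clamp_abs[measurable]: "clamp_abs k \<in> borel_measurable borel"
  unfolding clamp_abs_def[abs_def] by measurable

lemma borel_measurable_lipschitz:
  fixes g :: "'a::metric_space \<Rightarrow> real"
  assumes "sets M = sets (restrict_space borel \<Omega>)" "L-lipschitz_on UNIV g"
  shows "g \<in> borel_measurable M"
  using measurable_restrict_space1[OF borel_measurable_continuous_onI[OF lipschitz_on_continuous_on[OF assms(2)]]]
    assms(1) by (simp cong: measurable_cong_sets)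

text \<open>The tents \<open>max 0 (1 - real k * infdist x C)\<close> decrease to the indicator of
  \<open>C\<close>, as a point outside a closed set has positive distance from it. Nonemptiness
  matters: \<open>infdist\<close> to the empty set is 0 by convention, and the tents would be
  constantly 1.\<close>

lemma closed_indicator_approx:
  fixes M :: "'a::metric_space measure"
  assumes "finite_measure M" "sets M = sets (restrict_space borel \<Omega>)" "closed C" "C \<noteq> {}" "0 < e"
  shows "\<exists>g L. L-lipschitz_on UNIV g \<and> (\<integral>\<^sup>+x. ennreal \<bar>indicator C x - g x\<bar> \<partial>M) < ennreal e"
proof -
  interpret finite_measure M by fact
  define g where "g k x = max 0 (1 - real k * infdist x C)" for k and x :: 'a
  have [measurable_cong]: "sets M = sets (restrict_space borel \<Omega>)" by fact
  have lip: "(real k)-lipschitz_on UNIV (g k)" for k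
  proof (rule lipschitz_onI)
    fix x y :: 'a
    have "\<bar>g k x - g k y\<bar> \<le> \<bar>real k * infdist x C - real k * infdist y C\<bar>"
      unfolding g_def by (auto simp: max_def)
    also have "\<dots> = real k * \<bar>infdist x C - infdist y C\<bar>"
      by (simp add: abs_mult flip: right_diff_distrib)
    also have "\<dots> \<le> real k * dist x y" by (intro mult_left_mono infdist_triangle_abs) auto
    finally show "dist (g k x) (g k y) \<le> real k * dist x y" by (simp add: dist_real_def)
  qed simp
  have [measurable]: "g k \<in> borel_measurable M" for k
    by (rule borel_measurable_lipschitz[OF assms(2) lip])
  have [measurable]: "(\<lambda>x. indicator C x :: real) \<in> borel_measurable M"
    using measurable_restrict_space1[of "indicator C :: 'a \<Rightarrow> real" borel borel \<Omega>] \<open>closed C\<close>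
    by (simp cong: measurable_cong_sets)
  have lim: "(\<lambda>k. g k x) \<longlonglongrightarrow> indicator C x" for x
  proof (cases "x \<in> C")
    case True
    then show ?thesis by (simp add: g_def)
  next
    case False
    then have d: "0 < infdist x C"
      using \<open>closed C\<close> \<open>C \<noteq> {}\<close> by (metis in_closed_iff_infdist_zero infdist_nonneg order_le_less)
    then obtain k0 :: nat where k0: "1 < real k0 * infdist x C"
      using reals_Archimedean3 by blast
    have "\<forall>\<^sub>F k in sequentially. g k x = indicator C x"
      using eventually_ge_at_top[of k0]
    proof eventually_elim
      case (elim k)
      then have "real k0 * infdist x C \<le> real k * infdist x C" using d by (intro mult_right_mono) auto
      then show ?case using k0 False by (simp add: g_def)
    qed
    then show ?thesis by (rule tendsto_eventually)
  qed
  have "(\<lambda>k. \<integral>\<^sup>+x. ennreal \<bar>indicator C x - g k x\<bar> \<partial>M) \<longlonglongrightarrow> (\<integral>\<^sup>+x. 0 \<partial>M)"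
  proof (rule nn_integral_dominated_convergence[where w="\<lambda>_. 1"])
    show "AE x in M. ennreal \<bar>indicator C x - g k x\<bar> \<le> 1" for k
    proof (rule AE_I2)
      fix x
      have "0 \<le> g k x" "g k x \<le> 1" by (auto simp: g_def infdist_nonneg)
      then show "ennreal \<bar>indicator C x - g k x\<bar> \<le> 1"
        by (auto simp: indicator_def)
    qed
    show "AE x in M. (\<lambda>k. ennreal \<bar>indicator C x - g k x\<bar>) \<longlonglongrightarrow> 0"
    proof (rule AE_I2)
      fix x
      have "(\<lambda>k. \<bar>indicator C x - g k x\<bar>) \<longlonglongrightarrow> \<bar>indicator C x - indicator C x\<bar>"
        by (intro tendsto_intros lim)
      then show "(\<lambda>k. ennreal \<bar>indicator C x - g k x\<bar>) \<longlonglongrightarrow> 0"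
        by (simp add: ennreal_tendsto_0_iff)
    qed
  qed (auto simp: less_top[symmetric])
  then have "(\<lambda>k. \<integral>\<^sup>+x. ennreal \<bar>indicator C x - g k x\<bar> \<partial>M) \<longlonglongrightarrow> 0" by simp
  from ennreal_tendsto_0D[OF this \<open>0 < e\<close>] obtain k where
    "(\<integral>\<^sup>+x. ennreal \<bar>indicator C x - g k x\<bar> \<partial>M) < ennreal e"
    by (auto simp: eventually_sequentially)
  then show ?thesis using lip by blast
qed

lemma borel_measurable_ident_restrict:
  "sets M = sets (restrict_space borel \<Omega>) \<Longrightarrow> (\<lambda>x. x) \<in> borel_measurable M"
  using measurable_restrict_space1[OF measurable_ident_sets[OF refl], of borel \<Omega>]
  by (simp cong: measurable_cong_sets)

text \<open>Finite Borel measures on a Polish space are inner regular: a compact subset of nearly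
  full measure is closed in the whole space, so the closed case applies to it.\<close>

lemma indicator_lipschitz_approx:
  fixes M :: "'a::{second_countable_topology, complete_space} measure"
  assumes "finite_measure M" "sets M = sets (restrict_space borel \<Omega>)" "A \<in> sets M" "0 < e"
  shows "\<exists>g L. L-lipschitz_on UNIV g \<and> (\<integral>\<^sup>+x. ennreal \<bar>indicator A x - g x\<bar> \<partial>M) < ennreal e"
proof -
  interpret finite_measure M by fact
  \<comment> \<open>Inner regularity concerns measures on all of \<open>borel\<close>;
    \<open>N\<close> is the extension of \<open>M\<close> by 0 outside
    \<open>\<Omega>\<close>.\<close>
  define N where "N = distr M borel (\<lambda>x. x)"
  have [measurable]: "(\<lambda>x. x) \<in> M \<rightarrow>\<^sub>M borel"
    by (rule borel_measurable_ident_restrict[OF assms(2)])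
  obtain B where B: "B \<in> sets borel" "A = \<Omega> \<inter> B"
    using assms(2,3) by (auto simp: sets_restrict_space)
  have sp: "space M = \<Omega>"
    using sets_eq_imp_space_eq[OF assms(2)] by (simp add: space_restrict_space)
  have N: "emeasure N D = emeasure M (D \<inter> \<Omega>)" if "D \<in> sets borel" for D
    unfolding N_def using that by (simp add: emeasure_distr sp)
  have fin: "emeasure N D < \<infinity>" for D
    unfolding N_def by (metis emeasure_finite finite_measure.emeasure_finite finite_measure_distr
        \<open>(\<lambda>x. x) \<in> M \<rightarrow>\<^sub>M borel\<close> infinity_ennreal_def less_top)
  have fin2: "emeasure N (space N) \<noteq> \<infinity>" using fin[of "space N"] by simp
  have reg: "emeasure N B = (SUP K \<in> {K. K \<subseteq> B \<and> compact K}. emeasure N K)"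
    by (rule inner_regular[OF _ fin2 B(1)]) (simp add: N_def)
  have "\<exists>K. K \<subseteq> B \<and> closed K \<and> emeasure N B \<le> emeasure N K + ennreal (e/2)"
  \<comment> \<open>For a null set the strict inequality used in the other case has no room; there
    the empty set serves as \<open>K\<close>.\<close>
  proof (cases "emeasure N B = 0")
    case True
    then show ?thesis by (intro exI[of _ "{}"]) auto
  next
    case False
    have "emeasure N B - ennreal (e/2) < emeasure N B"
      using False fin[of B] \<open>0 < e\<close>
      by (cases "emeasure N B") (auto simp: ennreal_minus intro!: ennreal_lessI)
    then obtain K where "K \<subseteq> B" "compact K" "emeasure N B - ennreal (e/2) < emeasure N K"
      unfolding reg less_SUP_iff by auto
    then show ?thesis
      by (intro exI[of _ K])
        (auto simp: compact_imp_closed ennreal_minus_le_iff add.commute dest!: less_imp_le)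
  qed
  then obtain K where K: "K \<subseteq> B" "closed K" "emeasure N B \<le> emeasure N K + ennreal (e/2)"
    by blast
  have [measurable]: "K \<in> sets borel" using K(2) by auto
  have mK: "K \<inter> \<Omega> \<in> sets M" using assms(2) \<open>K \<in> sets borel\<close> by (auto simp: sets_restrict_space)
  have "\<exists>g L. L-lipschitz_on UNIV g \<and> (\<integral>\<^sup>+x. ennreal \<bar>indicator K x - g x\<bar> \<partial>M) < ennreal (e/2)"
  proof (cases "K = {}")
    case True
    then show ?thesis using \<open>0 < e\<close> by (intro exI[of _ "\<lambda>_. 0"] exI[of _ 0]) (auto intro: lipschitz_on_constant)
  next
    case False
    then show ?thesis using closed_indicator_approx[OF assms(1,2) K(2)] \<open>0 < e\<close> by simp
  qed
  then obtain g L where g: "L-lipschitz_on UNIV g"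
    "(\<integral>\<^sup>+x. ennreal \<bar>indicator K x - g x\<bar> \<partial>M) < ennreal (e/2)" by blast
  have [measurable]: "g \<in> borel_measurable M" by (rule borel_measurable_lipschitz[OF assms(2) g(1)])
  have [measurable]: "(\<lambda>x. indicator K x :: real) \<in> borel_measurable M"
    "(\<lambda>x. indicator A x :: real) \<in> borel_measurable M"
    using assms(3) by (auto intro!: measurable_compose[OF \<open>(\<lambda>x. x) \<in> M \<rightarrow>\<^sub>M borel\<close>])
  have "(\<integral>\<^sup>+x. ennreal \<bar>indicator A x - g x\<bar> \<partial>M)
      \<le> (\<integral>\<^sup>+x. indicator (A - K) x + ennreal \<bar>indicator K x - g x\<bar> \<partial>M)"
  proof (rule nn_integral_mono)
    fix x assume "x \<in> space M"
    then show "ennreal \<bar>indicator A x - g x\<bar> \<le> indicator (A - K) x + ennreal \<bar>indicator K x - g x\<bar>"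
    proof (cases "x \<in> A - K")
      case True
      \<comment> \<open>Here the indicator of \<open>K\<close> vanishes, so the second summand is
        the absolute value of \<open>g x\<close>, and the indicator of \<open>A - K\<close> pays for
        the 1.\<close>
      have "ennreal \<bar>1 - g x\<bar> \<le> ennreal (1 + \<bar>g x\<bar>)" by (intro ennreal_leI) auto
      then show ?thesis using True by (auto simp: ennreal_plus)
    next
      case False
      then show ?thesis using K(1) B(2) sp \<open>x \<in> space M\<close> by (auto simp: indicator_def)
    qed
  qed
  also have "\<dots> = emeasure M (A - K) + (\<integral>\<^sup>+x. ennreal \<bar>indicator K x - g x\<bar> \<partial>M)"
  proof -
    have "A - K = A - (K \<inter> \<Omega>)" using B by auto
    then have "A - K \<in> sets M" using assms(3) mK by auto
    then show ?thesis by (subst nn_integral_add) auto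
  qed
  also have "emeasure M (A - K) \<le> ennreal (e/2)"
  proof -
    have "A - K = A - (K \<inter> \<Omega>)" using B by auto
    also have "emeasure M \<dots> = emeasure M A - emeasure M (K \<inter> \<Omega>)"
      using assms(3) mK K(1) B(2) by (intro emeasure_Diff) auto
    also have "\<dots> \<le> ennreal (e/2)"
      using K(3) N[OF B(1)] N[OF \<open>K \<in> sets borel\<close>] B(2)
      by (simp add: ennreal_minus_le_iff Int_commute)
    finally show ?thesis .
  qed
  also have "ennreal (e/2) + (\<integral>\<^sup>+x. ennreal \<bar>indicator K x - g x\<bar> \<partial>M) < ennreal (e/2) + ennreal (e/2)"
    using g(2) by (simp add: ennreal_add_left_cancel_less)
  also have "\<dots> = ennreal e" using \<open>0 < e\<close> by (simp flip: ennreal_plus)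
  finally show ?thesis using g(1) by (meson add_right_mono order_le_less_trans)
qed

lemma nn_integral_abs_diff_triangle:
  fixes f g h :: "'a \<Rightarrow> real"
  assumes [measurable]: "f \<in> borel_measurable M" "g \<in> borel_measurable M" "h \<in> borel_measurable M"
  shows "(\<integral>\<^sup>+x. ennreal \<bar>f x - h x\<bar> \<partial>M)
    \<le> (\<integral>\<^sup>+x. ennreal \<bar>f x - g x\<bar> \<partial>M) + (\<integral>\<^sup>+x. ennreal \<bar>g x - h x\<bar> \<partial>M)"
  by (subst nn_integral_add[symmetric]) (auto intro!: nn_integral_mono ennreal_leI simp flip: ennreal_plus)

text \<open>Induction over integrable functions: approximability passes from indicators to
  multiples, sums and dominated limits.\<close>

lemma integrable_lipschitz_approx:
  fixes M :: "'a::{second_countable_topology, complete_space} measure"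
  assumes "finite_measure M" "sets M = sets (restrict_space borel \<Omega>)"
    and "integrable M (u :: 'a \<Rightarrow> real)" "0 < e"
  shows "\<exists>g L. L-lipschitz_on UNIV g \<and> (\<integral>\<^sup>+x. ennreal \<bar>u x - g x\<bar> \<partial>M) < ennreal e"
  using assms(3,4)
proof (induction arbitrary: e rule: integrable_induct)
  case (base A c)
  \<comment> \<open>Adding 1 to the denominator covers \<open>c = 0\<close> and leaves a strict
    inequality after multiplication by the absolute value of \<open>c\<close>.\<close>
  have "0 < e / (\<bar>c\<bar> + 1)" using base by (simp add: add_nonneg_pos)
  from indicator_lipschitz_approx[OF assms(1,2) base(1) this] obtain g L where
    g: "L-lipschitz_on UNIV g" "(\<integral>\<^sup>+x. ennreal \<bar>indicator A x - g x\<bar> \<partial>M) < ennreal (e / (\<bar>c\<bar> + 1))"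
    by blast
  have [measurable]: "g \<in> borel_measurable M" by (rule borel_measurable_lipschitz[OF assms(2) g(1)])
  have "(\<integral>\<^sup>+x. ennreal \<bar>indicator A x *\<^sub>R c - c * g x\<bar> \<partial>M)
      = (\<integral>\<^sup>+x. ennreal \<bar>c\<bar> * ennreal \<bar>indicator A x - g x\<bar> \<partial>M)"
    by (intro nn_integral_cong) (simp add: algebra_simps flip: ennreal_mult abs_mult)
  also have "\<dots> = ennreal \<bar>c\<bar> * (\<integral>\<^sup>+x. ennreal \<bar>indicator A x - g x\<bar> \<partial>M)"
    using base(1) by (intro nn_integral_cmult) simp
  also have "\<dots> \<le> ennreal \<bar>c\<bar> * ennreal (e / (\<bar>c\<bar> + 1))"
    using g(2) by (intro mult_left_mono) auto
  also have "\<dots> < ennreal e"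
    using base(3) by (simp add: ennreal_less_iff field_simps add_pos_nonneg flip: ennreal_mult)
  finally show ?case using lipschitz_on_cmult_real[OF g(1), of c] by blast
next
  case (add f1 f2)
  from add.IH(1)[of "e/2"] add.prems obtain g1 L1 where g1: "L1-lipschitz_on UNIV g1"
    "(\<integral>\<^sup>+x. ennreal \<bar>f1 x - g1 x\<bar> \<partial>M) < ennreal (e/2)" by auto
  from add.IH(2)[of "e/2"] add.prems obtain g2 L2 where g2: "L2-lipschitz_on UNIV g2"
    "(\<integral>\<^sup>+x. ennreal \<bar>f2 x - g2 x\<bar> \<partial>M) < ennreal (e/2)" by auto
  have [measurable]: "g1 \<in> borel_measurable M" "g2 \<in> borel_measurable M"
    using borel_measurable_lipschitz[OF assms(2)] g1(1) g2(1) by auto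
  have [measurable]: "f1 \<in> borel_measurable M" "f2 \<in> borel_measurable M" using add.hyps by auto
  have "(\<integral>\<^sup>+x. ennreal \<bar>f1 x + f2 x - (g1 x + g2 x)\<bar> \<partial>M)
    \<le> (\<integral>\<^sup>+x. ennreal \<bar>f1 x - g1 x\<bar> + ennreal \<bar>f2 x - g2 x\<bar> \<partial>M)"
    by (intro nn_integral_mono) (auto intro!: ennreal_leI simp flip: ennreal_plus)
  also have "\<dots> = (\<integral>\<^sup>+x. ennreal \<bar>f1 x - g1 x\<bar> \<partial>M) + (\<integral>\<^sup>+x. ennreal \<bar>f2 x - g2 x\<bar> \<partial>M)"
    by (intro nn_integral_add) auto
  also have "\<dots> < ennreal (e/2) + ennreal (e/2)" using g1 g2 by (intro add_strict_mono) auto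
  also have "\<dots> = ennreal e" using add.prems by (simp flip: ennreal_plus)
  finally show ?case using lipschitz_on_add[OF g1(1) g2(1)] by blast
next
  case (lim f s)
  have [measurable]: "f \<in> borel_measurable M" "s i \<in> borel_measurable M" for i using lim.hyps by auto
  have "(\<lambda>i. \<integral>\<^sup>+x. ennreal \<bar>f x - s i x\<bar> \<partial>M) \<longlonglongrightarrow> (\<integral>\<^sup>+x. 0 \<partial>M)"
  \<comment> \<open>The induction rule supplies \<open>s i\<close> bounded by twice \<open>f\<close>
    in absolute value, hence the factor 3 for the difference.\<close>
  proof (rule nn_integral_dominated_convergence[where w="\<lambda>x. ennreal (3 * \<bar>f x\<bar>)"])
    show "AE x in M. ennreal \<bar>f x - s i x\<bar> \<le> ennreal (3 * \<bar>f x\<bar>)" for i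
    proof (rule AE_I2)
      fix x assume "x \<in> space M"
      then show "ennreal \<bar>f x - s i x\<bar> \<le> ennreal (3 * \<bar>f x\<bar>)"
        using lim.hyps(3)[of x i] by (intro ennreal_leI) auto
    qed
    have "integrable M (\<lambda>x. 3 * \<bar>f x\<bar>)" using lim.hyps by auto
    then show "(\<integral>\<^sup>+x. ennreal (3 * \<bar>f x\<bar>) \<partial>M) < \<infinity>"
      unfolding integrable_iff_bounded by simp
    show "AE x in M. (\<lambda>i. ennreal \<bar>f x - s i x\<bar>) \<longlonglongrightarrow> 0"
    proof (rule AE_I2)
      fix x assume "x \<in> space M"
      then have "(\<lambda>i. \<bar>f x - s i x\<bar>) \<longlonglongrightarrow> \<bar>f x - f x\<bar>" by (intro tendsto_intros lim.hyps)
      then show "(\<lambda>i. ennreal \<bar>f x - s i x\<bar>) \<longlonglongrightarrow> 0" by (simp add: ennreal_tendsto_0_iff)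
    qed
  qed auto
  then have "(\<lambda>i. \<integral>\<^sup>+x. ennreal \<bar>f x - s i x\<bar> \<partial>M) \<longlonglongrightarrow> 0" by simp
  from ennreal_tendsto_0D[OF this, of "e/2"] lim.prems obtain i where
    i: "(\<integral>\<^sup>+x. ennreal \<bar>f x - s i x\<bar> \<partial>M) < ennreal (e/2)"
    by (auto simp: eventually_sequentially)
  from lim.IH[of "e/2" i] lim.prems obtain g L where g: "L-lipschitz_on UNIV g"
    "(\<integral>\<^sup>+x. ennreal \<bar>s i x - g x\<bar> \<partial>M) < ennreal (e/2)" by auto
  have [measurable]: "g \<in> borel_measurable M" by (rule borel_measurable_lipschitz[OF assms(2) g(1)])
  have "(\<integral>\<^sup>+x. ennreal \<bar>f x - g x\<bar> \<partial>M)
      \<le> (\<integral>\<^sup>+x. ennreal \<bar>f x - s i x\<bar> \<partial>M) + (\<integral>\<^sup>+x. ennreal \<bar>s i x - g x\<bar> \<partial>M)"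
    by (rule nn_integral_abs_diff_triangle) auto
  also have "\<dots> < ennreal (e/2) + ennreal (e/2)" using i g by (intro add_strict_mono) auto
  also have "\<dots> = ennreal e" using lim.prems by (simp flip: ennreal_plus)
  finally show ?case using g(1) by blast
qed

text \<open>Dominated convergence with bound \<open>\<bar>u x\<bar> powr r\<close>; at each point
  the error is even equal to 0 from some \<open>k\<close> on.\<close>

lemma clamp_approx:
  assumes "u \<in> borel_measurable M" "abs_moment r M u < \<infinity>" "0 < r" "0 < e"
  shows "\<exists>k::nat. abs_moment r M (\<lambda>x. u x - clamp_abs (real k) (u x)) < ennreal e"
proof -
  have [measurable]: "u \<in> borel_measurable M" by fact
  have "(\<lambda>k. abs_moment r M (\<lambda>x. u x - clamp_abs (real k) (u x))) \<longlonglongrightarrow> (\<integral>\<^sup>+x. 0 \<partial>M)"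
    unfolding abs_moment_def
  proof (rule nn_integral_dominated_convergence[where w="\<lambda>x. ennreal (\<bar>u x\<bar> powr r)"])
    show "AE x in M. ennreal (\<bar>u x - clamp_abs (real k) (u x)\<bar> powr r) \<le> ennreal (\<bar>u x\<bar> powr r)" for k
      using \<open>0 < r\<close> by (intro AE_I2 ennreal_leI powr_mono2) (auto simp: clamp_abs_def max_def min_def)
    show "(\<integral>\<^sup>+x. ennreal (\<bar>u x\<bar> powr r) \<partial>M) < \<infinity>" using assms unfolding abs_moment_def by simp
    show "AE x in M. (\<lambda>k. ennreal (\<bar>u x - clamp_abs (real k) (u x)\<bar> powr r)) \<longlonglongrightarrow> 0"
    proof (rule AE_I2)
      fix x
      obtain k0 :: nat where k0: "\<bar>u x\<bar> \<le> real k0" using real_arch_simple by blast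
      have "\<forall>\<^sub>F k in sequentially. ennreal (\<bar>u x - clamp_abs (real k) (u x)\<bar> powr r) = 0"
        using eventually_ge_at_top[of k0]
        by eventually_elim (use k0 in \<open>simp add: clamp_abs_id\<close>)
      then show "(\<lambda>k. ennreal (\<bar>u x - clamp_abs (real k) (u x)\<bar> powr r)) \<longlonglongrightarrow> 0"
        by (rule tendsto_eventually)
    qed
  qed auto
  then have "(\<lambda>k. abs_moment r M (\<lambda>x. u x - clamp_abs (real k) (u x))) \<longlonglongrightarrow> 0" by simp
  from ennreal_tendsto_0D[OF this \<open>0 < e\<close>] show ?thesis by (auto simp: eventually_sequentially)
qed

text \<open>One factor \<open>t\<close> is kept and the remaining power is bounded. For bounded
  functions a first moment thus controls the r-th, which upgrades L^1 estimates to L^r.\<close>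

lemma powr_le_bounded:
  fixes t :: real
  assumes "0 \<le> t" "t \<le> c" "1 \<le> r"
  shows "t powr r \<le> c powr (r - 1) * t"
proof (cases "t = 0")
  case False
  then have "t powr r = t powr (r - 1) * t" using assms by (simp add: powr_mult_base' powr_diff)
  also have "\<dots> \<le> c powr (r - 1) * t"
    using assms by (intro mult_right_mono powr_mono2) auto
  finally show ?thesis .
qed (use assms in simp)

text \<open>Truncate \<open>u\<close> at a height \<open>k\<close>, approximate the truncation in
  L^1, and truncate the approximant at the same height. The last operation does not increase the
  distance, since clamping is 1-Lipschitz and fixes the truncated \<open>u\<close>; between
  functions bounded by \<open>k\<close>, closeness in L^1 gives closeness in L^r.\<close>

lemma bounded_lipschitz_dense:
  fixes M :: "'a::{second_countable_topology, complete_space} measure"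
  assumes "prob_space M" "sets M = sets (restrict_space borel \<Omega>)"
    and "u \<in> borel_measurable M" "abs_moment r M u < \<infinity>" "1 \<le> r" "0 < e"
  shows "\<exists>g\<in>bounded_lipschitz. abs_moment r M (\<lambda>x. u x - g x) < ennreal e"
proof -
  interpret prob_space M by fact
  have [measurable]: "u \<in> borel_measurable M" by fact
  \<comment> \<open>Two errors of this size pass through \<open>abs_moment_add_le\<close>, whose
    factor is \<open>2 powr r\<close>.\<close>
  define e1 where "e1 = e / (2 * 2 powr r)"
  have e1: "0 < e1" using assms by (simp add: e1_def)
  obtain k0 :: nat where k0: "abs_moment r M (\<lambda>x. u x - clamp_abs (real k0) (u x)) < ennreal e1"
    using clamp_approx[OF assms(3,4) _ e1] assms(5) by auto
  define k where "k = real k0"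
  define v where "v x = clamp_abs k (u x)" for x
  have [measurable]: "v \<in> borel_measurable M" unfolding v_def by measurable
  have vk: "\<bar>v x\<bar> \<le> k" for x unfolding v_def k_def by (rule abs_clamp_abs) simp
  have "integrable M v" using vk by (intro integrable_const_bound[where B=k]) auto
  \<comment> \<open>The factor from \<open>powr_le_bounded\<close> for differences bounded by
    \<open>2 * k\<close>. It can be 0, when \<open>k\<close> is 0; hence the tolerance is divided by
    \<open>c + 1\<close>.\<close>
  define c where "c = (2 * k) powr (r - 1)"
  have "0 < e1 / (c + 1)" using e1 by (simp add: c_def add_nonneg_pos)
  from integrable_lipschitz_approx[OF _ assms(2) \<open>integrable M v\<close> this] obtain g L where
    g: "L-lipschitz_on UNIV g" "(\<integral>\<^sup>+x. ennreal \<bar>v x - g x\<bar> \<partial>M) < ennreal (e1 / (c + 1))"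
    using finite_measure_axioms by blast
  have [measurable]: "g \<in> borel_measurable M" by (rule borel_measurable_lipschitz[OF assms(2) g(1)])
  define g' where "g' x = clamp_abs k (g x)" for x
  have [measurable]: "g' \<in> borel_measurable M" unfolding g'_def by measurable
  have "L-lipschitz_on UNIV g'"
    using g(1) clamp_abs_dist unfolding lipschitz_on_def g'_def dist_real_def
    by (meson order_trans)
  moreover have g'k: "\<bar>g' x\<bar> \<le> k" for x unfolding g'_def k_def by (rule abs_clamp_abs) simp
  ultimately have "g' \<in> bounded_lipschitz" unfolding bounded_lipschitz_def by blast
  have "abs_moment r M (\<lambda>x. v x - g' x) \<le> (\<integral>\<^sup>+x. ennreal c * ennreal \<bar>v x - g x\<bar> \<partial>M)"
    unfolding abs_moment_def
  proof (rule nn_integral_mono)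
    fix x
    have "\<bar>v x - g' x\<bar> \<le> 2 * k" using vk[of x] g'k[of x] by auto
    then have "\<bar>v x - g' x\<bar> powr r \<le> c * \<bar>v x - g' x\<bar>"
      unfolding c_def using \<open>1 \<le> r\<close> by (intro powr_le_bounded) auto
    also have "\<dots> \<le> c * \<bar>v x - g x\<bar>"
      using clamp_abs_dist[of k "v x" "g x"] clamp_abs_id[OF vk[of x]]
      by (intro mult_left_mono) (auto simp: c_def g'_def)
    finally show "ennreal (\<bar>v x - g' x\<bar> powr r) \<le> ennreal c * ennreal \<bar>v x - g x\<bar>"
      by (simp add: ennreal_leI c_def flip: ennreal_mult)
  qed
  also have "\<dots> = ennreal c * (\<integral>\<^sup>+x. ennreal \<bar>v x - g x\<bar> \<partial>M)"
    by (intro nn_integral_cmult) simp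
  also have "\<dots> \<le> ennreal c * ennreal (e1 / (c + 1))"
    using g(2) by (intro mult_left_mono) auto
  also have "\<dots> < ennreal e1"
    using e1 by (simp add: ennreal_less_iff field_simps add_pos_nonneg c_def flip: ennreal_mult)
  finally have 2: "abs_moment r M (\<lambda>x. v x - g' x) < ennreal e1" .
  have "abs_moment r M (\<lambda>x. u x - g' x)
      \<le> ennreal (2 powr r) * (abs_moment r M (\<lambda>x. u x - v x) + abs_moment r M (\<lambda>x. v x - g' x))"
    using \<open>1 \<le> r\<close> by (intro abs_moment_add_le) auto
  also have "\<dots> < ennreal (2 powr r) * (ennreal e1 + ennreal e1)"
    using k0 2 by (intro ennreal_mult_strict_left_mono add_strict_mono) (auto simp: v_def k_def)
  also have "\<dots> = ennreal e" using e1 by (simp add: e1_def flip: ennreal_plus ennreal_mult)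
  finally show ?thesis using \<open>g' \<in> bounded_lipschitz\<close> by blast
qed

section \<open>Couplings and convergence in $TL^r$\<close>

text \<open>Near-minimisers with slack 1/(n+1): the infimum need not be attained.\<close>

lemma INF_tendsto_0_choice:
  fixes J :: "nat \<Rightarrow> 'a \<Rightarrow> real"
  assumes "\<And>n. S n \<noteq> {}" "\<And>n s. s \<in> S n \<Longrightarrow> 0 \<le> J n s"
    and "(\<lambda>n. INF s\<in>S n. J n s) \<longlonglongrightarrow> 0"
  shows "\<exists>\<sigma>. (\<forall>n. \<sigma> n \<in> S n) \<and> (\<lambda>n. J n (\<sigma> n)) \<longlonglongrightarrow> 0"
proof -
  have "\<exists>s\<in>S n. J n s < (INF s\<in>S n. J n s) + 1 / real (Suc n)" for n
  proof -
    \<comment> \<open>A real-valued infimum is governed by its members only when it is taken over a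
      nonempty set bounded below.\<close>
    have "bdd_below (J n ` S n)" using assms(2) by (intro bdd_belowI[of _ 0]) auto
    then show ?thesis by (intro iffD1[OF cINF_less_iff[OF assms(1)]]) simp_all
  qed
  then have "\<forall>n. \<exists>s. s \<in> S n \<and> J n s < (INF s\<in>S n. J n s) + 1 / real (Suc n)" by blast
  then obtain \<sigma> where \<sigma>: "\<And>n. \<sigma> n \<in> S n" "\<And>n. J n (\<sigma> n) < (INF s\<in>S n. J n s) + 1 / real (Suc n)"
    unfolding choice_iff by blast
  have "(\<lambda>n. (INF s\<in>S n. J n s) + 1 / real (Suc n)) \<longlonglongrightarrow> 0 + 0"
    by (rule tendsto_add[OF assms(3) LIMSEQ_Suc[OF lim_1_over_n]])
  then have lim: "(\<lambda>n. (INF s\<in>S n. J n s) + 1 / real (Suc n)) \<longlonglongrightarrow> 0" by simp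
  have "(\<lambda>n. J n (\<sigma> n)) \<longlonglongrightarrow> 0"
    by (rule tendsto_sandwich[OF _ _ tendsto_const lim])
      (intro always_eventually allI assms(2) \<sigma>(1) less_imp_le[OF \<sigma>(2)])+
  then show ?thesis using \<sigma> by blast
qed

abbreviation displacement :: "'a::real_normed_vector \<times> 'a \<Rightarrow> real" where
  "displacement z \<equiv> norm (fst z - snd z)"

text \<open>The product measure is a coupling. Without one, the infimum in \<open>TL_dist\<close>
  would range over the empty set and carry no information.\<close>

lemma couplings_nonempty:
  assumes "prob_space \<mu>" "prob_space \<nu>"
  shows "couplings \<mu> \<nu> \<noteq> {}"
proof -
  interpret \<mu>: prob_space \<mu> by fact
  interpret \<nu>: prob_space \<nu> by fact
  interpret pair_prob_space \<mu> \<nu> ..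
  have "distr (\<mu> \<Otimes>\<^sub>M \<nu>) \<nu> snd = \<nu>"
  proof (rule measure_eqI)
    fix A assume "A \<in> sets (distr (\<mu> \<Otimes>\<^sub>M \<nu>) \<nu> snd)"
    then have A: "A \<in> sets \<nu>" by simp
    have "snd -` A \<inter> space (\<mu> \<Otimes>\<^sub>M \<nu>) = space \<mu> \<times> A"
      using sets.sets_into_space[OF A] by (auto simp: space_pair_measure)
    then show "emeasure (distr (\<mu> \<Otimes>\<^sub>M \<nu>) \<nu> snd) A = emeasure \<nu> A"
      using A by (simp add: emeasure_distr \<nu>.emeasure_pair_measure_Times \<mu>.emeasure_space_1)
  qed simp
  then have "\<mu> \<Otimes>\<^sub>M \<nu> \<in> couplings \<mu> \<nu>"
    using \<nu>.distr_pair_fst[of \<mu>] prob_space_axioms by (simp add: couplings_def)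
  then show ?thesis by blast
qed

lemma prob_momentD:
  assumes "\<mu> \<in> prob_moment \<Omega> r"
  shows "prob_space \<mu>" "sets \<mu> = sets (restrict_space borel \<Omega>)"
    "(\<lambda>x. x) \<in> borel_measurable \<mu>" "abs_moment r \<mu> norm < \<infinity>"
proof -
  show "prob_space \<mu>" and s: "sets \<mu> = sets (restrict_space borel \<Omega>)"
    using assms by (auto simp: prob_moment_def)
  show m: "(\<lambda>x. x) \<in> borel_measurable \<mu>"
    by (rule borel_measurable_ident_restrict[OF s])
  show "abs_moment r \<mu> norm < \<infinity>"
    using assms integrable_abs_powr_iff[of norm \<mu> r] m by (auto simp: prob_moment_def)
qed

lemma prob_moment_mono:
  assumes "0 < p" "p \<le> q"
  shows "prob_moment \<Omega> q \<subseteq> prob_moment \<Omega> p"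
proof
  fix \<mu> assume \<mu>: "\<mu> \<in> prob_moment \<Omega> q"
  note d = prob_momentD[OF \<mu>]
  have [measurable]: "norm \<in> borel_measurable \<mu>" using d(3) by simp
  have "abs_moment p \<mu> norm < \<infinity>" using abs_moment_finite_lower[OF d(1) _ assms d(4)] by simp
  then show "\<mu> \<in> prob_moment \<Omega> p"
    using d integrable_abs_powr_iff[of norm \<mu> p] by (auto simp: prob_moment_def)
qed

text \<open>The sigma-algebra of \<open>\<pi>\<close> is the product of those of its marginals and
  not \<open>borel\<close>; measurability of the identity into \<open>borel\<close> on each marginal
  is what makes \<open>displacement\<close> measurable.\<close>

locale coupling =
  fixes \<mu> \<nu> :: "(real ^ 'd) measure" and \<pi>
  assumes \<mu>: "(\<lambda>x. x) \<in> borel_measurable \<mu>"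
    and \<nu>: "(\<lambda>x. x) \<in> borel_measurable \<nu>"
    and coupling: "\<pi> \<in> couplings \<mu> \<nu>"
begin

sublocale prob_space \<pi>
  using coupling by (simp add: couplings_def)

lemma measurable_marginals[measurable]: "fst \<in> \<pi> \<rightarrow>\<^sub>M \<mu>" "snd \<in> \<pi> \<rightarrow>\<^sub>M \<nu>"
  using coupling by (auto simp: couplings_def cong: measurable_cong_sets)

lemma measurable_displacement[measurable]: "displacement \<in> borel_measurable \<pi>"
  using measurable_compose[OF measurable_marginals(1) \<mu>] measurable_compose[OF measurable_marginals(2) \<nu>]
  by measurable

lemma abs_moment_fst:
  assumes [measurable]: "f \<in> borel_measurable \<mu>"
  shows "abs_moment r \<pi> (\<lambda>z. f (fst z)) = abs_moment r \<mu> f"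
proof -
  have "abs_moment r \<mu> f = abs_moment r (distr \<pi> \<mu> fst) f"
    using coupling by (simp add: couplings_def)
  also have "\<dots> = abs_moment r \<pi> (\<lambda>z. f (fst z))"
    unfolding abs_moment_def by (subst nn_integral_distr) auto
  finally show ?thesis ..
qed

lemma abs_moment_snd:
  assumes [measurable]: "f \<in> borel_measurable \<nu>"
  shows "abs_moment r \<pi> (\<lambda>z. f (snd z)) = abs_moment r \<nu> f"
proof -
  have "abs_moment r \<nu> f = abs_moment r (distr \<pi> \<nu> snd) f"
    using coupling by (simp add: couplings_def)
  also have "\<dots> = abs_moment r \<pi> (\<lambda>z. f (snd z))"
    unfolding abs_moment_def by (subst nn_integral_distr) auto
  finally show ?thesis ..
qed

lemma abs_moment_diff_finite:
  assumes "u \<in> Lp_space r \<mu>" "w \<in> Lp_space r \<nu>" "0 \<le> r"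
  shows "abs_moment r \<pi> (\<lambda>z. u (fst z) - w (snd z)) < \<infinity>"
proof -
  have [measurable]: "u \<in> borel_measurable \<mu>" "w \<in> borel_measurable \<nu>"
    using assms by (auto simp: Lp_space_iff)
  have "abs_moment r \<pi> (\<lambda>z. u (fst z) - w (snd z)) \<le> ennreal (2 powr r) * (abs_moment r \<mu> u + abs_moment r \<nu> w)"
    using assms(3) abs_moment_add_le[of "\<lambda>z. u (fst z)" \<pi> "\<lambda>z. w (snd z)" r "\<lambda>z. u (fst z) - w (snd z)"]
    by (auto simp: abs_moment_fst abs_moment_snd)
  also have "\<dots> < \<infinity>" using assms by (simp add: Lp_space_iff ennreal_mult_less_top)
  finally show ?thesis .
qed

lemma displacement_moment_finite:
  assumes "\<mu> \<in> prob_moment \<Omega> r" "\<nu> \<in> prob_moment \<Omega> r" "0 \<le> r"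
  shows "abs_moment r \<pi> displacement < \<infinity>"
proof -
  have [measurable]: "norm \<in> borel_measurable \<mu>" "norm \<in> borel_measurable \<nu>"
    using \<mu> \<nu> by auto
  have "abs_moment r \<pi> displacement \<le> ennreal (2 powr r) * (abs_moment r \<mu> norm + abs_moment r \<nu> norm)"
    using assms(3) abs_moment_add_le[of "\<lambda>z. norm (fst z)" \<pi> "\<lambda>z. norm (snd z)" r displacement]
    by (auto simp: abs_moment_fst abs_moment_snd norm_triangle_ineq4)
  also have "\<dots> < \<infinity>"
    using prob_momentD(4)[OF assms(1)] prob_momentD(4)[OF assms(2)] by (simp add: ennreal_mult_less_top)
  finally show ?thesis .
qed

text \<open>A Bochner integral defaults to 0 for a non-integrable function, so the passage to
  \<open>ennreal\<close> depends on both parts of the cost being finite, which membership in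
  \<open>TL\<close> guarantees for every coupling.\<close>

lemma TL_cost_eq:
  assumes "(u, \<mu>) \<in> TL \<Omega> r" "(w, \<nu>) \<in> TL \<Omega> r" "0 \<le> r"
  shows "ennreal (\<integral>z. \<bar>u (fst z) - w (snd z)\<bar> powr r + displacement z powr r \<partial>\<pi>)
    = abs_moment r \<pi> (\<lambda>z. u (fst z) - w (snd z)) + abs_moment r \<pi> displacement"
proof -
  have [measurable]: "u \<in> borel_measurable \<mu>" "w \<in> borel_measurable \<nu>"
    using assms by (auto simp: TL_def Lp_space_iff)
  have f: "abs_moment r \<pi> (\<lambda>z. u (fst z) - w (snd z)) < \<infinity>" "abs_moment r \<pi> displacement < \<infinity>"
    using assms abs_moment_diff_finite displacement_moment_finite by (auto simp: TL_def)
  have int1: "integrable \<pi> (\<lambda>z. \<bar>u (fst z) - w (snd z)\<bar> powr r)"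
    by (rule iffD2[OF integrable_abs_powr_iff f(1)]) measurable
  have int2: "integrable \<pi> (\<lambda>z. displacement z powr r)"
    using iffD2[OF integrable_abs_powr_iff[OF measurable_displacement] f(2)] unfolding abs_norm_cancel .
  have "abs_moment r \<pi> (\<lambda>z. u (fst z) - w (snd z)) = ennreal (\<integral>z. \<bar>u (fst z) - w (snd z)\<bar> powr r \<partial>\<pi>)"
    by (rule abs_moment_eq_integral[OF _ f(1)]) measurable
  moreover have "abs_moment r \<pi> displacement = ennreal (\<integral>z. displacement z powr r \<partial>\<pi>)"
    using abs_moment_eq_integral[OF measurable_displacement f(2)] unfolding abs_norm_cancel .
  ultimately show ?thesis
    unfolding Bochner_Integration.integral_add[OF int1 int2]
    by (subst ennreal_plus) (auto intro!: integral_nonneg_AE)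
qed

lemma displacement_cost_eq:
  assumes "\<mu> \<in> prob_moment \<Omega> r" "\<nu> \<in> prob_moment \<Omega> r" "0 \<le> r"
  shows "ennreal (\<integral>z. displacement z powr r \<partial>\<pi>) = abs_moment r \<pi> displacement"
  using abs_moment_eq_integral[OF measurable_displacement displacement_moment_finite[OF assms]]
  unfolding abs_norm_cancel by (rule sym)

end

text \<open>The infimum is approached by near-optimal couplings. Once the r-th root is undone, their
  cost is a sum of two non-negative terms, each of which must vanish in the limit.\<close>

lemma TL_converges_imp_couplings:
  assumes conv: "TL_converges \<Omega> r (\<lambda>n. (u n, \<mu> n)) (w, \<nu>)" and "0 < r"
  shows "\<exists>\<pi>. (\<forall>n. \<pi> n \<in> couplings (\<mu> n) \<nu>)
    \<and> (\<lambda>n. abs_moment r (\<pi> n) (\<lambda>z. u n (fst z) - w (snd z))) \<longlonglongrightarrow> 0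
    \<and> (\<lambda>n. abs_moment r (\<pi> n) displacement) \<longlonglongrightarrow> 0"
proof -
  have TL: "(u n, \<mu> n) \<in> TL \<Omega> r" "(w, \<nu>) \<in> TL \<Omega> r" for n
    using conv by (auto simp: TL_converges_def)
  then have pm: "\<mu> n \<in> prob_moment \<Omega> r" "\<nu> \<in> prob_moment \<Omega> r" for n by (auto simp: TL_def)
  define J where "J n \<pi> = (\<integral>z. \<bar>u n (fst z) - w (snd z)\<bar> powr r + displacement z powr r \<partial>\<pi>)" for n \<pi>
  have J0: "0 \<le> J n \<pi>" for n \<pi> unfolding J_def by (intro integral_nonneg_AE) auto
  have "(\<lambda>n. INF \<pi>\<in>couplings (\<mu> n) \<nu>. J n \<pi> powr (1 / r)) \<longlonglongrightarrow> 0"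
    using conv by (simp add: TL_converges_def TL_dist_def J_def)
  from INF_tendsto_0_choice[OF _ _ this] obtain \<pi> where \<pi>: "\<And>n. \<pi> n \<in> couplings (\<mu> n) \<nu>"
    "(\<lambda>n. J n (\<pi> n) powr (1 / r)) \<longlonglongrightarrow> 0"
    using couplings_nonempty[OF prob_momentD(1)[OF pm(1)] prob_momentD(1)[OF pm(2)]] by auto
  have "(\<lambda>n. (J n (\<pi> n) powr (1 / r)) powr r) \<longlonglongrightarrow> 0 powr r"
    using \<pi>(2) \<open>0 < r\<close> J0 by (intro tendsto_powr') auto
  then have "(\<lambda>n. J n (\<pi> n)) \<longlonglongrightarrow> 0" using J0 \<open>0 < r\<close> by (simp add: powr_powr)
  then have lim: "(\<lambda>n. ennreal (J n (\<pi> n))) \<longlonglongrightarrow> 0" using J0 by (simp add: ennreal_tendsto_0_iff)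
  have eq: "ennreal (J n (\<pi> n))
      = abs_moment r (\<pi> n) (\<lambda>z. u n (fst z) - w (snd z)) + abs_moment r (\<pi> n) displacement" for n
  proof -
    interpret coupling "\<mu> n" \<nu> "\<pi> n"
      using pm prob_momentD(3) \<pi>(1) by unfold_locales auto
    show ?thesis
      unfolding J_def by (rule TL_cost_eq[OF TL(1) TL(2)]) (rule less_imp_le[OF \<open>0 < r\<close>])
  qed
  have "abs_moment r (\<pi> n) (\<lambda>z. u n (fst z) - w (snd z)) \<le> ennreal (J n (\<pi> n))"
    "abs_moment r (\<pi> n) displacement \<le> ennreal (J n (\<pi> n))" for n
    unfolding eq by (rule add_increasing2 add_increasing; rule zero_le order_refl)+
  then have "(\<lambda>n. abs_moment r (\<pi> n) (\<lambda>z. u n (fst z) - w (snd z))) \<longlonglongrightarrow> 0"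
    "(\<lambda>n. abs_moment r (\<pi> n) displacement) \<longlonglongrightarrow> 0"
    by (auto intro!: tendsto_sandwich[OF _ _ tendsto_const lim])
  then show ?thesis using \<pi>(1) by blast
qed

text \<open>The infimum lies between 0 and the cost of any single coupling, so the couplings may be
  chosen freely and need not be near-optimal.\<close>

lemma TL_convergesI:
  assumes TL: "\<And>n. (u n, \<mu> n) \<in> TL \<Omega> r" "(w, \<nu>) \<in> TL \<Omega> r"
    and "0 < r" and \<pi>: "\<And>n. \<pi> n \<in> couplings (\<mu> n) \<nu>"
    and lim: "(\<lambda>n. abs_moment r (\<pi> n) (\<lambda>z. u n (fst z) - w (snd z))) \<longlonglongrightarrow> 0"
      "(\<lambda>n. abs_moment r (\<pi> n) displacement) \<longlonglongrightarrow> 0"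
  shows "TL_converges \<Omega> r (\<lambda>n. (u n, \<mu> n)) (w, \<nu>)"
proof -
  have pm: "\<mu> n \<in> prob_moment \<Omega> r" "\<nu> \<in> prob_moment \<Omega> r" for n using TL by (auto simp: TL_def)
  define J where "J n \<pi> = (\<integral>z. \<bar>u n (fst z) - w (snd z)\<bar> powr r + displacement z powr r \<partial>\<pi>)" for n \<pi>
  have J0: "0 \<le> J n \<pi>" for n \<pi> unfolding J_def by (intro integral_nonneg_AE) auto
  have eq: "ennreal (J n (\<pi> n))
      = abs_moment r (\<pi> n) (\<lambda>z. u n (fst z) - w (snd z)) + abs_moment r (\<pi> n) displacement" for n
  proof -
    interpret coupling "\<mu> n" \<nu> "\<pi> n"
      using pm prob_momentD(3) \<pi> by unfold_locales auto
    show ?thesis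
      unfolding J_def by (rule TL_cost_eq[OF TL(1) TL(2)]) (rule less_imp_le[OF \<open>0 < r\<close>])
  qed
  have "(\<lambda>n. ennreal (J n (\<pi> n))) \<longlonglongrightarrow> 0 + 0"
    unfolding eq by (intro tendsto_add lim)
  then have "(\<lambda>n. J n (\<pi> n)) \<longlonglongrightarrow> 0" using J0 by (simp add: ennreal_tendsto_0_iff)
  then have "(\<lambda>n. J n (\<pi> n) powr (1 / r)) \<longlonglongrightarrow> 0 powr (1 / r)"
    using \<open>0 < r\<close> J0 by (intro tendsto_powr') auto
  then have lim': "(\<lambda>n. J n (\<pi> n) powr (1 / r)) \<longlonglongrightarrow> 0" using \<open>0 < r\<close> by simp
  have D: "TL_dist r (u n, \<mu> n) (w, \<nu>) = (INF \<pi>\<in>couplings (\<mu> n) \<nu>. J n \<pi> powr (1 / r))" for n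
    by (simp add: TL_dist_def J_def)
  have "TL_dist r (u n, \<mu> n) (w, \<nu>) \<le> J n (\<pi> n) powr (1 / r)" for n
    unfolding D by (rule cINF_lower[OF _ \<pi>]) (auto intro: bdd_belowI[of _ 0])
  moreover have "0 \<le> TL_dist r (u n, \<mu> n) (w, \<nu>)" for n
    unfolding D using \<pi> by (intro cINF_greatest) auto
  ultimately have "(\<lambda>n. TL_dist r (u n, \<mu> n) (w, \<nu>)) \<longlonglongrightarrow> 0"
    by (intro tendsto_sandwich[OF _ _ tendsto_const lim']) auto
  then show ?thesis using TL by (simp add: TL_converges_def)
qed

text \<open>Couplings for a limit function to which no convergent sequence is attached yet: they can
  only come from the convergence of the measures, and approximants are then built along
  them.\<close>

lemma wasserstein_tendsto_0_imp_couplings: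
  assumes pm: "\<And>n. \<mu> n \<in> prob_moment \<Omega> r" "\<nu> \<in> prob_moment \<Omega> r" and "0 < r"
    and lim: "(\<lambda>n. wasserstein r (\<mu> n) \<nu>) \<longlonglongrightarrow> 0"
  shows "\<exists>\<pi>. (\<forall>n. \<pi> n \<in> couplings (\<mu> n) \<nu>) \<and> (\<lambda>n. abs_moment r (\<pi> n) displacement) \<longlonglongrightarrow> 0"
proof -
  define J where "J \<pi> = (\<integral>z. displacement z powr r \<partial>\<pi>)" for \<pi> :: "((real ^ 'a) \<times> (real ^ 'a)) measure"
  have J0: "0 \<le> J \<pi>" for \<pi> unfolding J_def by (intro integral_nonneg_AE) auto
  have "(\<lambda>n. INF \<pi>\<in>couplings (\<mu> n) \<nu>. J \<pi> powr (1 / r)) \<longlonglongrightarrow> 0"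
    using lim by (simp add: wasserstein_def J_def)
  from INF_tendsto_0_choice[OF _ _ this] obtain \<pi> where \<pi>: "\<And>n. \<pi> n \<in> couplings (\<mu> n) \<nu>"
    "(\<lambda>n. J (\<pi> n) powr (1 / r)) \<longlonglongrightarrow> 0"
    using couplings_nonempty[OF prob_momentD(1)[OF pm(1)] prob_momentD(1)[OF pm(2)]] by auto
  have "(\<lambda>n. (J (\<pi> n) powr (1 / r)) powr r) \<longlonglongrightarrow> 0 powr r"
    using \<pi>(2) \<open>0 < r\<close> J0 by (intro tendsto_powr') auto
  then have "(\<lambda>n. J (\<pi> n)) \<longlonglongrightarrow> 0" using J0 \<open>0 < r\<close> by (simp add: powr_powr)
  then have "(\<lambda>n. ennreal (J (\<pi> n))) \<longlonglongrightarrow> 0" using J0 by (simp add: ennreal_tendsto_0_iff)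
  moreover have "ennreal (J (\<pi> n)) = abs_moment r (\<pi> n) displacement" for n
  proof -
    interpret coupling "\<mu> n" \<nu> "\<pi> n"
      using pm prob_momentD(3) \<pi>(1) by unfold_locales auto
    show ?thesis unfolding J_def using \<open>0 < r\<close> pm by (intro displacement_cost_eq) auto
  qed
  ultimately show ?thesis using \<pi>(1) by auto
qed

section \<open>Moments along a sequence of couplings\<close>

text \<open>No exponent occurs among the parameters, so couplings obtained from convergence in TL^r
  and in TL^s are instances of one and the same locale and can be compared.\<close>

locale coupling_sequence =
  fixes \<Omega> :: "(real ^ 'd) set" and \<mu> :: "nat \<Rightarrow> (real ^ 'd) measure" and \<nu> and \<pi>
  assumes sets_\<mu>: "\<And>n. sets (\<mu> n) = sets (restrict_space borel \<Omega>)"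
    and sets_\<nu>: "sets \<nu> = sets (restrict_space borel \<Omega>)"
    and prob_space_\<nu>: "prob_space \<nu>"
    and couplings: "\<And>n. \<pi> n \<in> couplings (\<mu> n) \<nu>"
begin

lemma coupling: "coupling (\<mu> n) \<nu> (\<pi> n)"
proof
  show "(\<lambda>x. x) \<in> borel_measurable (\<mu> n)" "(\<lambda>x. x) \<in> borel_measurable \<nu>"
    by (rule borel_measurable_ident_restrict[OF sets_\<mu>] borel_measurable_ident_restrict[OF sets_\<nu>])+
qed (rule couplings)

lemma prob_space_\<pi>: "prob_space (\<pi> n)"
  using couplings by (simp add: couplings_def)

lemmas measurable_marginals[measurable] = coupling.measurable_marginals[OF coupling]
lemmas measurable_displacement[measurable] = coupling.measurable_displacement[OF coupling]
lemmas abs_moment_fst = coupling.abs_moment_fst[OF coupling]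
lemmas abs_moment_snd = coupling.abs_moment_snd[OF coupling]

lemma displacement_tendsto_lower:
  assumes "0 < p" "p \<le> q" "(\<lambda>n. abs_moment q (\<pi> n) displacement) \<longlonglongrightarrow> 0"
  shows "(\<lambda>n. abs_moment p (\<pi> n) displacement) \<longlonglongrightarrow> 0"
  by (rule abs_moment_tendsto_lower[OF prob_space_\<pi> measurable_displacement assms])

lemma bounded_lipschitz_measurable:
  assumes "g \<in> bounded_lipschitz"
  shows "g \<in> borel_measurable (\<mu> n)" "g \<in> borel_measurable \<nu>"
  using assms borel_measurable_lipschitz[OF sets_\<mu>] borel_measurable_lipschitz[OF sets_\<nu>]
  by (auto simp: bounded_lipschitz_def)

text \<open>The increment of \<open>g\<close> is at most \<open>2 * B\<close> and at most
  \<open>L\<close> times the displacement. Bounding \<open>r - 1\<close> of the factors by the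
  former and one by the latter leaves only a first moment of the displacement, whatever
  \<open>r\<close> is.\<close>

lemma bounded_lipschitz_tendsto:
  assumes g: "g \<in> bounded_lipschitz" and "1 \<le> r"
    and lim: "(\<lambda>n. abs_moment 1 (\<pi> n) displacement) \<longlonglongrightarrow> 0"
  shows "(\<lambda>n. abs_moment r (\<pi> n) (\<lambda>z. g (fst z) - g (snd z))) \<longlonglongrightarrow> 0"
proof -
  obtain B L where B: "\<And>x. \<bar>g x\<bar> \<le> B" and L: "L-lipschitz_on UNIV g"
    using g by (auto simp: bounded_lipschitz_def)
  define c where "c = (2 * B) powr (r - 1) * L"
  have "0 \<le> L" using L by (rule lipschitz_on_nonneg)
  then have "0 \<le> c" by (simp add: c_def)
  have "abs_moment r (\<pi> n) (\<lambda>z. g (fst z) - g (snd z)) \<le> ennreal c * abs_moment 1 (\<pi> n) displacement" for n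
  proof -
    have "\<bar>g (fst z) - g (snd z)\<bar> powr r \<le> c * displacement z" for z
    proof -
      have "\<bar>g (fst z) - g (snd z)\<bar> powr r \<le> (2 * B) powr (r - 1) * \<bar>g (fst z) - g (snd z)\<bar>"
        using B[of "fst z"] B[of "snd z"] \<open>1 \<le> r\<close> by (intro powr_le_bounded) auto
      also have "\<dots> \<le> (2 * B) powr (r - 1) * (L * displacement z)"
        using lipschitz_onD[OF L, of "fst z" "snd z"]
        by (intro mult_left_mono) (auto simp: dist_real_def dist_norm)
      finally show ?thesis by (simp add: c_def)
    qed
    then have "abs_moment r (\<pi> n) (\<lambda>z. g (fst z) - g (snd z))
        \<le> (\<integral>\<^sup>+z. ennreal c * ennreal (\<bar>displacement z\<bar> powr 1) \<partial>\<pi> n)"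
      unfolding abs_moment_def using \<open>0 \<le> c\<close>
      by (intro nn_integral_mono) (simp add: ennreal_leI flip: ennreal_mult)
    also have "\<dots> = ennreal c * abs_moment 1 (\<pi> n) displacement"
      unfolding abs_moment_def by (intro nn_integral_cmult) simp
    finally show ?thesis .
  qed
  then show ?thesis
    by (intro tendsto_sandwich[OF _ _ tendsto_const ennreal_cmult_tendsto_0[OF lim, of c]]) auto
qed

text \<open>Closeness in L^1 does not control squares, but it does bound the square of the truncated
  limit from above, because squaring is Lipschitz with constant \<open>2 * k\<close> on values up to
  \<open>k\<close>. Fatou's lemma in \<open>k\<close> then removes the truncation.\<close>

lemma abs_moment_liminf:
  assumes [measurable]: "\<And>n. F n \<in> borel_measurable (\<mu> n)" "G \<in> borel_measurable \<nu>"
    and lim: "(\<lambda>n. abs_moment 1 (\<pi> n) (\<lambda>z. F n (fst z) - G (snd z))) \<longlonglongrightarrow> 0"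
  shows "abs_moment 2 \<nu> G \<le> liminf (\<lambda>n. abs_moment 2 (\<mu> n) (F n))"
proof -
  have trunc: "abs_moment 2 \<nu> (\<lambda>x. clamp_abs (real k) (G x)) \<le> liminf (\<lambda>n. abs_moment 2 (\<mu> n) (F n))" for k
  proof (rule ennreal_le_epsilon)
    fix e :: real assume e: "0 < e"
    define c where "c = 2 * real k"
    have c: "0 \<le> c" by (simp add: c_def)
    have le: "abs_moment 2 \<nu> (\<lambda>x. clamp_abs (real k) (G x))
        \<le> abs_moment 2 (\<mu> n) (F n) + ennreal c * abs_moment 1 (\<pi> n) (\<lambda>z. F n (fst z) - G (snd z))" for n
    proof -
      have pw: "\<bar>clamp_abs (real k) a\<bar> ^ 2 \<le> \<bar>b\<bar> ^ 2 + c * \<bar>b - a\<bar>" for a b :: real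
      proof -
        let ?m = "\<bar>clamp_abs (real k) a\<bar>"
        have m: "?m \<le> \<bar>a\<bar>" "?m \<le> real k" by (auto simp: clamp_abs_def max_def min_def)
        show ?thesis
        proof (cases "?m \<le> \<bar>b\<bar>")
          case True
          then have "?m ^ 2 \<le> \<bar>b\<bar> ^ 2" by (intro power_mono) auto
          moreover have "0 \<le> c * \<bar>b - a\<bar>" using c by simp
          ultimately show ?thesis by linarith
        next
          case False
          \<comment> \<open>With \<open>\<bar>b\<bar> < ?m\<close> the first factor is at most the
            distance of \<open>a\<close> and \<open>b\<close>, as
            \<open>?m \<le> \<bar>a\<bar>\<close>; the second is at most \<open>2 * k\<close>, as
            both terms are at most \<open>k\<close>. The product is the difference of the
            squares.\<close>
          have "(?m - \<bar>b\<bar>) * (?m + \<bar>b\<bar>) \<le> \<bar>b - a\<bar> * c"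
            unfolding c_def using False m by (intro mult_mono) auto
          then show ?thesis by (simp add: power2_eq_square algebra_simps)
        qed
      qed
      have "abs_moment 2 \<nu> (\<lambda>x. clamp_abs (real k) (G x))
          = abs_moment 2 (\<pi> n) (\<lambda>z. clamp_abs (real k) (G (snd z)))"
        by (rule abs_moment_snd[symmetric]) measurable
      also have "\<dots> \<le> (\<integral>\<^sup>+z. ennreal (\<bar>F n (fst z)\<bar> powr 2) + ennreal c * ennreal (\<bar>F n (fst z) - G (snd z)\<bar> powr 1) \<partial>\<pi> n)"
        unfolding abs_moment_def using pw c
        by (intro nn_integral_mono) (simp add: ennreal_leI flip: ennreal_mult ennreal_plus)
      also have "\<dots> = abs_moment 2 (\<pi> n) (\<lambda>z. F n (fst z)) + ennreal c * abs_moment 1 (\<pi> n) (\<lambda>z. F n (fst z) - G (snd z))"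
        unfolding abs_moment_def by (subst nn_integral_add) (auto simp: nn_integral_cmult)
      finally show ?thesis by (simp add: abs_moment_fst)
    qed
    have "\<forall>\<^sub>F n in sequentially. ennreal c * abs_moment 1 (\<pi> n) (\<lambda>z. F n (fst z) - G (snd z)) < ennreal e"
      using ennreal_cmult_tendsto_0[OF lim, of c] e by (rule ennreal_tendsto_0D)
    \<comment> \<open>Moved to the left by truncated subtraction, \<open>e\<close> becomes part of a
      constant that bounds the sequence from below, as \<open>Liminf_bounded\<close>
      requires.\<close>
    then have "\<forall>\<^sub>F n in sequentially. abs_moment 2 \<nu> (\<lambda>x. clamp_abs (real k) (G x)) - ennreal e \<le> abs_moment 2 (\<mu> n) (F n)"
    proof (rule eventually_mono)
      fix n
      assume "ennreal c * abs_moment 1 (\<pi> n) (\<lambda>z. F n (fst z) - G (snd z)) < ennreal e"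
      from add_left_mono[OF less_imp_le[OF this], of "abs_moment 2 (\<mu> n) (F n)"]
      have "abs_moment 2 \<nu> (\<lambda>x. clamp_abs (real k) (G x)) \<le> abs_moment 2 (\<mu> n) (F n) + ennreal e"
        by (rule order_trans[OF le])
      then show "abs_moment 2 \<nu> (\<lambda>x. clamp_abs (real k) (G x)) - ennreal e \<le> abs_moment 2 (\<mu> n) (F n)"
        unfolding minus_ennreal_le_iff .
    qed
    then have "abs_moment 2 \<nu> (\<lambda>x. clamp_abs (real k) (G x)) - ennreal e \<le> liminf (\<lambda>n. abs_moment 2 (\<mu> n) (F n))"
      by (rule Liminf_bounded)
    then show "abs_moment 2 \<nu> (\<lambda>x. clamp_abs (real k) (G x)) \<le> liminf (\<lambda>n. abs_moment 2 (\<mu> n) (F n)) + ennreal e"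
      unfolding minus_ennreal_le_iff .
  qed
  have pw: "liminf (\<lambda>k. ennreal (\<bar>clamp_abs (real k) (G x)\<bar> powr 2)) = ennreal (\<bar>G x\<bar> powr 2)" for x
  proof -
    obtain k0 :: nat where k0: "\<bar>G x\<bar> \<le> real k0" using real_arch_simple by blast
    have "\<forall>\<^sub>F k in sequentially. ennreal (\<bar>clamp_abs (real k) (G x)\<bar> powr 2) = ennreal (\<bar>G x\<bar> powr 2)"
      using eventually_ge_at_top[of k0]
      by eventually_elim (use k0 in \<open>simp add: clamp_abs_id\<close>)
    then show ?thesis by (intro lim_imp_Liminf tendsto_eventually) auto
  qed
  have "abs_moment 2 \<nu> G = (\<integral>\<^sup>+x. liminf (\<lambda>k. ennreal (\<bar>clamp_abs (real k) (G x)\<bar> powr 2)) \<partial>\<nu>)"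
    unfolding abs_moment_def pw ..
  also have "\<dots> \<le> liminf (\<lambda>k. abs_moment 2 \<nu> (\<lambda>x. clamp_abs (real k) (G x)))"
    unfolding abs_moment_def by (intro nn_integral_liminf) measurable
  also have "\<dots> \<le> liminf (\<lambda>k::nat. liminf (\<lambda>n. abs_moment 2 (\<mu> n) (F n)))"
    by (intro Liminf_mono always_eventually allI trunc)
  also have "\<dots> = liminf (\<lambda>n. abs_moment 2 (\<mu> n) (F n))" by (simp add: Liminf_const)
  finally show ?thesis .
qed

text \<open>The weighted inequality \<open>b^2 \<le> (1 + d) * a^2 + (1 + 1/d) * (b - a)^2\<close>
  keeps the factor of the limit term near 1; the factor \<open>2 powr r\<close> of
  \<open>abs_moment_add_le\<close> would be too coarse here.\<close>

lemma abs_moment_limsup: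
  assumes [measurable]: "\<And>n. F n \<in> borel_measurable (\<mu> n)" "G \<in> borel_measurable \<nu>"
    and lim: "(\<lambda>n. abs_moment 2 (\<pi> n) (\<lambda>z. F n (fst z) - G (snd z))) \<longlonglongrightarrow> 0"
  shows "limsup (\<lambda>n. abs_moment 2 (\<mu> n) (F n)) \<le> abs_moment 2 \<nu> G"
proof (rule ennreal_le_epsilon)
  \<comment> \<open>\<open>ennreal_le_epsilon\<close> also lets the bound be assumed finite, so the
    second moment \<open>A\<close> of \<open>G\<close> is a real number.\<close>
  fix e :: real assume e: "0 < e" and fin: "abs_moment 2 \<nu> G < top"
  then obtain A where A: "0 \<le> A" "abs_moment 2 \<nu> G = ennreal A"
    by (cases "abs_moment 2 \<nu> G") auto
  \<comment> \<open>Makes the excess \<open>d * A\<close> at most \<open>e / 2\<close>; the added 1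
    covers \<open>A = 0\<close>.\<close>
  define d where "d = e / (2 * (A + 1))"
  have d: "0 < d" "d * A \<le> e / 2"
    using e A by (auto simp: d_def field_simps add_pos_nonneg add_nonneg_pos)
  define c1 c2 where "c1 = 1 + d" and "c2 = 1 + 1 / d"
  have c: "0 \<le> c1" "0 \<le> c2" using d by (auto simp: c1_def c2_def)
  have le: "abs_moment 2 (\<mu> n) (F n)
      \<le> ennreal (A + e/2) + ennreal c2 * abs_moment 2 (\<pi> n) (\<lambda>z. F n (fst z) - G (snd z))" for n
  proof -
    have pw: "b ^ 2 \<le> c1 * a ^ 2 + c2 * (b - a) ^ 2" for a b :: real
    proof -
      \<comment> \<open>This square divided by \<open>d\<close> is exactly the difference of the two
        sides.\<close>
      have "0 \<le> (d * a - (b - a)) ^ 2 / d" using d by simp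
      also have "\<dots> = c1 * a ^ 2 + c2 * (b - a) ^ 2 - b ^ 2"
        unfolding c1_def c2_def using d by (simp add: power2_eq_square field_simps)
      finally show ?thesis by simp
    qed
    have "abs_moment 2 (\<mu> n) (F n) = abs_moment 2 (\<pi> n) (\<lambda>z. F n (fst z))"
      by (rule abs_moment_fst[symmetric]) measurable
    also have "\<dots> \<le> (\<integral>\<^sup>+z. ennreal c1 * ennreal (\<bar>G (snd z)\<bar> powr 2) + ennreal c2 * ennreal (\<bar>F n (fst z) - G (snd z)\<bar> powr 2) \<partial>\<pi> n)"
      unfolding abs_moment_def using pw c
      by (intro nn_integral_mono) (simp add: ennreal_leI flip: ennreal_mult ennreal_plus)
    also have "\<dots> = ennreal c1 * abs_moment 2 (\<pi> n) (\<lambda>z. G (snd z)) + ennreal c2 * abs_moment 2 (\<pi> n) (\<lambda>z. F n (fst z) - G (snd z))"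
      unfolding abs_moment_def by (subst nn_integral_add) (auto simp: nn_integral_cmult)
    also have "ennreal c1 * abs_moment 2 (\<pi> n) (\<lambda>z. G (snd z)) \<le> ennreal (A + e/2)"
    proof -
      have "c1 * A \<le> A + e/2" using d by (simp add: c1_def algebra_simps)
      then show ?thesis using c A by (simp add: abs_moment_snd ennreal_leI flip: ennreal_mult)
    qed
    finally show ?thesis by (simp add: add_right_mono)
  qed
  have "\<forall>\<^sub>F n in sequentially. ennreal c2 * abs_moment 2 (\<pi> n) (\<lambda>z. F n (fst z) - G (snd z)) < ennreal (e/2)"
    using ennreal_cmult_tendsto_0[OF lim, of c2] e by (intro ennreal_tendsto_0D) auto
  then have "\<forall>\<^sub>F n in sequentially. abs_moment 2 (\<mu> n) (F n) \<le> abs_moment 2 \<nu> G + ennreal e"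
  proof eventually_elim
    case (elim n)
    have "abs_moment 2 (\<mu> n) (F n) \<le> ennreal (A + e/2) + ennreal (e/2)"
      using le[of n] elim by (meson add_left_mono less_imp_le order_trans)
    also have "\<dots> = abs_moment 2 \<nu> G + ennreal e" using A e by (simp flip: ennreal_plus)
    finally show ?case .
  qed
  then show "limsup (\<lambda>n. abs_moment 2 (\<mu> n) (F n)) \<le> abs_moment 2 \<nu> G + ennreal e"
    by (rule Limsup_bounded)
qed

end

text \<open>
  The functions \<open>u n\<close> and \<open>w\<close> are compared with a bounded Lipschitz function \<open>g\<close> close to \<open>w\<close>: the distance of
  \<open>u n\<close> to \<open>g\<close> only depends on the first marginal, so no gluing of couplings is needed.
\<close>

lemma coupling_independence:
  assumes "coupling_sequence \<Omega> \<mu> \<nu> \<pi>" "coupling_sequence \<Omega> \<mu> \<nu> \<sigma>" and "1 \<le> r"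
    and [measurable]: "\<And>n. u n \<in> borel_measurable (\<mu> n)"
    and w: "w \<in> Lp_space r \<nu>"
    and \<pi>: "(\<lambda>n. abs_moment r (\<pi> n) (\<lambda>z. u n (fst z) - w (snd z))) \<longlonglongrightarrow> 0"
      "(\<lambda>n. abs_moment 1 (\<pi> n) displacement) \<longlonglongrightarrow> 0"
    and \<sigma>: "(\<lambda>n. abs_moment 1 (\<sigma> n) displacement) \<longlonglongrightarrow> 0"
  shows "(\<lambda>n. abs_moment r (\<sigma> n) (\<lambda>z. u n (fst z) - w (snd z))) \<longlonglongrightarrow> 0"
proof -
  interpret \<pi>: coupling_sequence \<Omega> \<mu> \<nu> \<pi> by fact
  interpret \<sigma>: coupling_sequence \<Omega> \<mu> \<nu> \<sigma> by fact
  have [measurable]: "w \<in> borel_measurable \<nu>" and fin: "abs_moment r \<nu> w < \<infinity>"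
    using w by (auto simp: Lp_space_iff)
  have r: "0 \<le> r" using \<open>1 \<le> r\<close> by simp
  let ?K = "ennreal (2 powr r)"
  show ?thesis
  proof (rule ennreal_tendsto_0_leI)
    fix e :: real assume e: "0 < e"
    \<comment> \<open>The denominator is the total factor that the error \<open>d\<close> collects
      in the nested uses of \<open>abs_moment_add_le\<close>: three of them on the way through
      \<open>\<pi>\<close>, two through \<open>\<sigma>\<close>.\<close>
    define d where "d = e / (2 powr r * 2 powr r * 2 powr r + 2 powr r * 2 powr r)"
    have pos: "0 < 2 powr r * 2 powr r * 2 powr r + 2 powr r * 2 powr (r::real)"
      by (intro add_pos_pos mult_pos_pos) auto
    have d: "0 < d" using e pos by (simp add: d_def)
    obtain g where g: "g \<in> bounded_lipschitz" and gd: "abs_moment r \<nu> (\<lambda>x. w x - g x) < ennreal d"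
      using bounded_lipschitz_dense[OF \<pi>.prob_space_\<nu> \<pi>.sets_\<nu> _ fin \<open>1 \<le> r\<close> d] by auto
    have [measurable]: "g \<in> borel_measurable (\<mu> n)" "g \<in> borel_measurable \<nu>" for n
      using \<pi>.bounded_lipschitz_measurable[OF g] by auto
    define a where "a n = abs_moment r (\<pi> n) (\<lambda>z. u n (fst z) - w (snd z))" for n
    define b where "b n = abs_moment r (\<pi> n) (\<lambda>z. g (fst z) - g (snd z))" for n
    define c where "c n = abs_moment r (\<sigma> n) (\<lambda>z. g (fst z) - g (snd z))" for n
    have a: "a \<longlonglongrightarrow> 0" using \<pi>(1) by (simp add: a_def[abs_def])
    have b: "b \<longlonglongrightarrow> 0"
      using \<pi>.bounded_lipschitz_tendsto[OF g \<open>1 \<le> r\<close> \<pi>(2)] by (simp add: b_def[abs_def])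
    have c: "c \<longlonglongrightarrow> 0"
      using \<sigma>.bounded_lipschitz_tendsto[OF g \<open>1 \<le> r\<close> \<sigma>] by (simp add: c_def[abs_def])
    have le: "abs_moment r (\<sigma> n) (\<lambda>z. u n (fst z) - w (snd z))
      \<le> ennreal e + (?K * (?K * a n) + ?K * (?K * (?K * b n)) + ?K * (?K * c n))" for n
    proof -
      have 1: "abs_moment r (\<pi> n) (\<lambda>z. w (snd z) - g (fst z)) \<le> ?K * (ennreal d + b n)"
      proof -
        have "abs_moment r (\<pi> n) (\<lambda>z. w (snd z) - g (fst z))
            \<le> ?K * (abs_moment r (\<pi> n) (\<lambda>z. w (snd z) - g (snd z)) + b n)"
          unfolding b_def using r by (intro abs_moment_add_le) auto
        also have "abs_moment r (\<pi> n) (\<lambda>z. w (snd z) - g (snd z)) = abs_moment r \<nu> (\<lambda>x. w x - g x)"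
          by (rule \<pi>.abs_moment_snd) measurable
        also have "?K * (abs_moment r \<nu> (\<lambda>x. w x - g x) + b n) \<le> ?K * (ennreal d + b n)"
          using gd by (intro mult_left_mono add_right_mono) auto
        finally show ?thesis .
      qed
      have 2: "abs_moment r (\<sigma> n) (\<lambda>z. g (fst z) - w (snd z)) \<le> ?K * (c n + ennreal d)"
      proof -
        have "abs_moment r (\<sigma> n) (\<lambda>z. g (fst z) - w (snd z))
            \<le> ?K * (c n + abs_moment r (\<sigma> n) (\<lambda>z. w (snd z) - g (snd z)))"
          unfolding c_def using r by (intro abs_moment_add_le) auto
        also have "abs_moment r (\<sigma> n) (\<lambda>z. w (snd z) - g (snd z)) = abs_moment r \<nu> (\<lambda>x. w x - g x)"
          by (rule \<sigma>.abs_moment_snd) measurable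
        also have "?K * (c n + abs_moment r \<nu> (\<lambda>x. w x - g x)) \<le> ?K * (c n + ennreal d)"
          using gd by (intro mult_left_mono add_left_mono) auto
        finally show ?thesis .
      qed
      have "abs_moment r (\<sigma> n) (\<lambda>z. u n (fst z) - g (fst z)) = abs_moment r (\<pi> n) (\<lambda>z. u n (fst z) - g (fst z))"
        using \<sigma>.abs_moment_fst[of "\<lambda>x. u n x - g x" n r] \<pi>.abs_moment_fst[of "\<lambda>x. u n x - g x" n r] by simp
      also have "\<dots> \<le> ?K * (a n + abs_moment r (\<pi> n) (\<lambda>z. w (snd z) - g (fst z)))"
        unfolding a_def using r by (intro abs_moment_add_le) auto
      also have "\<dots> \<le> ?K * (a n + ?K * (ennreal d + b n))"
        using 1 by (intro mult_left_mono add_left_mono) auto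
      finally have 3: "abs_moment r (\<sigma> n) (\<lambda>z. u n (fst z) - g (fst z)) \<le> ?K * (a n + ?K * (ennreal d + b n))" .
      have "abs_moment r (\<sigma> n) (\<lambda>z. u n (fst z) - w (snd z))
        \<le> ?K * (abs_moment r (\<sigma> n) (\<lambda>z. u n (fst z) - g (fst z)) + abs_moment r (\<sigma> n) (\<lambda>z. g (fst z) - w (snd z)))"
        using r by (intro abs_moment_add_le) auto
      also have "\<dots> \<le> ?K * (?K * (a n + ?K * (ennreal d + b n)) + ?K * (c n + ennreal d))"
        using 2 3 by (intro mult_left_mono add_mono) auto
      also have "\<dots> = (?K * ?K * ?K + ?K * ?K) * ennreal d
          + (?K * (?K * a n) + ?K * (?K * (?K * b n)) + ?K * (?K * c n))"
        by (simp add: algebra_simps)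
      also have "(?K * ?K * ?K + ?K * ?K) * ennreal d
          = ennreal ((2 powr r * 2 powr r * 2 powr r + 2 powr r * 2 powr r) * d)"
        using d by (simp add: ennreal_mult ennreal_plus)
      also have "(2 powr r * 2 powr r * 2 powr r + 2 powr r * 2 powr r) * d = e"
        using pos by (simp add: d_def)
      finally show ?thesis .
    qed
    have "(\<lambda>n. ?K * (?K * a n) + ?K * (?K * (?K * b n)) + ?K * (?K * c n)) \<longlonglongrightarrow> 0 + 0 + 0"
      by (intro tendsto_add ennreal_cmult_tendsto_0 a b c)
    then show "\<exists>g. g \<longlonglongrightarrow> 0 \<and> (\<forall>n. abs_moment r (\<sigma> n) (\<lambda>z. u n (fst z) - w (snd z)) \<le> ennreal e + g n)"
      using le by (intro exI[of _ "\<lambda>n. ?K * (?K * a n) + ?K * (?K * (?K * b n)) + ?K * (?K * c n)"]) auto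
  qed
qed

section \<open>Comparing TL convergence across couplings and exponents\<close>

lemma coupling_sequenceI:
  assumes "\<And>n. \<mu> n \<in> prob_moment \<Omega> r" "\<nu> \<in> prob_moment \<Omega> r" "\<And>n. \<pi> n \<in> couplings (\<mu> n) \<nu>"
  shows "coupling_sequence \<Omega> \<mu> \<nu> \<pi>"
  by (rule coupling_sequence.intro)
    (rule prob_momentD(2)[OF assms(1)] prob_momentD(2)[OF assms(2)] prob_momentD(1)[OF assms(2)] assms(3))+

lemma TL_convergesD:
  assumes "TL_converges \<Omega> r (\<lambda>n. (u n, \<mu> n)) (w, \<nu>)"
  shows "\<mu> n \<in> prob_moment \<Omega> r" "u n \<in> Lp_space r (\<mu> n)" "\<nu> \<in> prob_moment \<Omega> r" "w \<in> Lp_space r \<nu>"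
  using assms by (auto simp: TL_converges_def TL_def)

text \<open>The first moment of the displacement is recorded separately, being the form in which
  \<open>coupling_independence\<close> takes the transport cost for every exponent.\<close>

lemma TL_converges_imp_coupling_sequence:
  assumes conv: "TL_converges \<Omega> r (\<lambda>n. (u n, \<mu> n)) (w, \<nu>)" and "1 \<le> r"
  obtains \<pi> where "coupling_sequence \<Omega> \<mu> \<nu> \<pi>"
    "(\<lambda>n. abs_moment r (\<pi> n) (\<lambda>z. u n (fst z) - w (snd z))) \<longlonglongrightarrow> 0"
    "(\<lambda>n. abs_moment r (\<pi> n) displacement) \<longlonglongrightarrow> 0"
    "(\<lambda>n. abs_moment 1 (\<pi> n) displacement) \<longlonglongrightarrow> 0"
proof -
  have r: "0 < r" using \<open>1 \<le> r\<close> by simp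
  from TL_converges_imp_couplings[OF conv r] obtain \<pi> where
    \<pi>: "\<And>n. \<pi> n \<in> couplings (\<mu> n) \<nu>" and
    lim: "(\<lambda>n. abs_moment r (\<pi> n) (\<lambda>z. u n (fst z) - w (snd z))) \<longlonglongrightarrow> 0"
    "(\<lambda>n. abs_moment r (\<pi> n) displacement) \<longlonglongrightarrow> 0" by blast
  have seq: "coupling_sequence \<Omega> \<mu> \<nu> \<pi>"
    by (rule coupling_sequenceI[OF TL_convergesD(1,3)[OF conv] \<pi>])
  show ?thesis
    by (rule that[OF seq lim])
      (rule coupling_sequence.displacement_tendsto_lower[OF seq zero_less_one \<open>1 \<le> r\<close> lim(2)])
qed

lemma (in coupling_sequence) diff_tendsto_lower:
  assumes [measurable]: "\<And>n. u n \<in> borel_measurable (\<mu> n)" "w \<in> borel_measurable \<nu>"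
    and "0 < p" "p \<le> q"
    and "(\<lambda>n. abs_moment q (\<pi> n) (\<lambda>z. u n (fst z) - w (snd z))) \<longlonglongrightarrow> 0"
  shows "(\<lambda>n. abs_moment p (\<pi> n) (\<lambda>z. u n (fst z) - w (snd z))) \<longlonglongrightarrow> 0"
proof (rule abs_moment_tendsto_lower[OF prob_space_\<pi> _ assms(3-5)])
  show "(\<lambda>z. u n (fst z) - w (snd z)) \<in> borel_measurable (\<pi> n)" for n by measurable
qed

text \<open>The couplings that witness convergence for \<open>q\<close> also do so for
  \<open>p\<close>. Recovery sequences come with exponent \<open>max 2 p\<close> and are needed for
  \<open>p\<close> as well as for 2.\<close>

lemma TL_converges_lower:
  assumes conv: "TL_converges \<Omega> q (\<lambda>n. (u n, \<mu> n)) (w, \<nu>)" and "1 \<le> p" "p \<le> q"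
  shows "TL_converges \<Omega> p (\<lambda>n. (u n, \<mu> n)) (w, \<nu>)"
proof -
  have p: "0 < p" and q: "1 \<le> q" using assms by auto
  obtain \<pi> where seq: "coupling_sequence \<Omega> \<mu> \<nu> \<pi>" and
    lim: "(\<lambda>n. abs_moment q (\<pi> n) (\<lambda>z. u n (fst z) - w (snd z))) \<longlonglongrightarrow> 0"
    "(\<lambda>n. abs_moment q (\<pi> n) displacement) \<longlonglongrightarrow> 0"
    using TL_converges_imp_coupling_sequence[OF conv q] by blast
  interpret coupling_sequence \<Omega> \<mu> \<nu> \<pi> by fact
  note D = TL_convergesD[OF conv]
  have pm: "\<mu> n \<in> prob_moment \<Omega> p" "\<nu> \<in> prob_moment \<Omega> p" for n
    using prob_moment_mono[OF p \<open>p \<le> q\<close>] D(1)[of n] D(3) by (blast, blast)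
  have Lp: "u n \<in> Lp_space p (\<mu> n)" "w \<in> Lp_space p \<nu>" for n
    using Lp_space_mono[OF prob_momentD(1)[OF D(1)[of n]] p \<open>p \<le> q\<close>] D(2)[of n]
      Lp_space_mono[OF prob_momentD(1)[OF D(3)] p \<open>p \<le> q\<close>] D(4) by (blast, blast)
  have m: "u n \<in> borel_measurable (\<mu> n)" "w \<in> borel_measurable \<nu>" for n
    using Lp(1)[of n] Lp(2) by (simp_all add: Lp_space_iff)
  show ?thesis
  proof (rule TL_convergesI[OF _ _ p couplings])
    show "(u n, \<mu> n) \<in> TL \<Omega> p" "(w, \<nu>) \<in> TL \<Omega> p" for n
      using pm(1)[of n] pm(2) Lp(1)[of n] Lp(2) by (simp_all add: TL_def)
    show "(\<lambda>n. abs_moment p (\<pi> n) (\<lambda>z. u n (fst z) - w (snd z))) \<longlonglongrightarrow> 0"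
      by (rule diff_tendsto_lower[OF m p \<open>p \<le> q\<close> lim(1)])
    show "(\<lambda>n. abs_moment p (\<pi> n) displacement) \<longlonglongrightarrow> 0"
      by (rule displacement_tendsto_lower[OF p \<open>p \<le> q\<close> lim(2)])
  qed
qed

text \<open>The two sequences come with different couplings; those of \<open>h\<close> are exchanged
  for those of \<open>u\<close> by \<open>coupling_independence\<close>, after which both exponents
  are lowered to a common one. The lower bound uses \<open>t = 1\<close>, the upper bound
  \<open>t = 2\<close>.\<close>

lemma TL_converges_diff:
  assumes u: "TL_converges \<Omega> r (\<lambda>n. (u n, \<mu> n)) (w, \<nu>)"
    and h: "TL_converges \<Omega> s (\<lambda>n. (h n, \<mu> n)) (k, \<nu>)"
    and t: "1 \<le> t" "t \<le> r" "t \<le> s"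
  obtains \<pi> where "coupling_sequence \<Omega> \<mu> \<nu> \<pi>"
    "(\<lambda>n. abs_moment t (\<pi> n) (\<lambda>z. (u n (fst z) - h n (fst z)) - (w (snd z) - k (snd z)))) \<longlonglongrightarrow> 0"
proof -
  have t0: "0 < t" "1 \<le> r" "1 \<le> s" using t by auto
  obtain \<pi> where seq: "coupling_sequence \<Omega> \<mu> \<nu> \<pi>" and
    lim: "(\<lambda>n. abs_moment r (\<pi> n) (\<lambda>z. u n (fst z) - w (snd z))) \<longlonglongrightarrow> 0"
    "(\<lambda>n. abs_moment 1 (\<pi> n) displacement) \<longlonglongrightarrow> 0"
    using TL_converges_imp_coupling_sequence[OF u \<open>1 \<le> r\<close>] by blast
  obtain \<sigma> where seq': "coupling_sequence \<Omega> \<mu> \<nu> \<sigma>" and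
    lim': "(\<lambda>n. abs_moment s (\<sigma> n) (\<lambda>z. h n (fst z) - k (snd z))) \<longlonglongrightarrow> 0"
    "(\<lambda>n. abs_moment 1 (\<sigma> n) displacement) \<longlonglongrightarrow> 0"
    using TL_converges_imp_coupling_sequence[OF h \<open>1 \<le> s\<close>] by blast
  interpret coupling_sequence \<Omega> \<mu> \<nu> \<pi> by fact
  have m[measurable]: "u n \<in> borel_measurable (\<mu> n)" "w \<in> borel_measurable \<nu>"
    "h n \<in> borel_measurable (\<mu> n)" "k \<in> borel_measurable \<nu>" for n
    using TL_convergesD(2)[OF u, of n] TL_convergesD(4)[OF u] TL_convergesD(2)[OF h, of n] TL_convergesD(4)[OF h] by (simp_all add: Lp_space_iff)
  have "(\<lambda>n. abs_moment s (\<pi> n) (\<lambda>z. h n (fst z) - k (snd z))) \<longlonglongrightarrow> 0"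
    by (rule coupling_independence[OF seq' seq \<open>1 \<le> s\<close> m(3) TL_convergesD(4)[OF h] lim' lim(2)])
  then have h0: "(\<lambda>n. abs_moment t (\<pi> n) (\<lambda>z. h n (fst z) - k (snd z))) \<longlonglongrightarrow> 0"
    by (rule diff_tendsto_lower[OF m(3,4) \<open>0 < t\<close> \<open>t \<le> s\<close>])
  have u0: "(\<lambda>n. abs_moment t (\<pi> n) (\<lambda>z. u n (fst z) - w (snd z))) \<longlonglongrightarrow> 0"
    by (rule diff_tendsto_lower[OF m(1,2) \<open>0 < t\<close> \<open>t \<le> r\<close> lim(1)])
  have le: "abs_moment t (\<pi> n) (\<lambda>z. (u n (fst z) - h n (fst z)) - (w (snd z) - k (snd z)))
      \<le> ennreal (2 powr t) * (abs_moment t (\<pi> n) (\<lambda>z. u n (fst z) - w (snd z))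
          + abs_moment t (\<pi> n) (\<lambda>z. h n (fst z) - k (snd z)))" for n
    using t0 by (intro abs_moment_add_le) auto
  have "(\<lambda>n. abs_moment t (\<pi> n) (\<lambda>z. u n (fst z) - w (snd z))
          + abs_moment t (\<pi> n) (\<lambda>z. h n (fst z) - k (snd z))) \<longlonglongrightarrow> 0"
    using tendsto_add[OF u0 h0] by simp
  from ennreal_cmult_tendsto_0[OF this, of "2 powr t"]
  have "(\<lambda>n. abs_moment t (\<pi> n) (\<lambda>z. (u n (fst z) - h n (fst z)) - (w (snd z) - k (snd z)))) \<longlonglongrightarrow> 0"
    by (rule tendsto_sandwich[OF _ _ tendsto_const, rotated 2]) (intro always_eventually allI zero_le le)+
  then show ?thesis using that seq by blast
qed

section \<open>Semicontinuity of the quadratic term and approximation of limit functions\<close>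

lemma half_sq_integral_eq: "half_sq_integral M w = ereal (1/2) * enn2ereal (abs_moment 2 M w)"
  by (simp add: half_sq_integral_def abs_moment_def)

lemma half_sq_integral_nonneg: "0 \<le> half_sq_integral M w"
  by (simp add: half_sq_integral_eq)

lemma half_sq_integral_le_iff:
  assumes "0 \<le> c"
  shows "half_sq_integral M w \<le> ereal c \<longleftrightarrow> abs_moment 2 M w \<le> ennreal (2 * c)"
proof (cases "abs_moment 2 M w")
  case (real a)
  then show ?thesis using assms by (auto simp: half_sq_integral_eq ennreal_le_iff2)
next
  case top
  then show ?thesis using assms by (auto simp: half_sq_integral_eq top_unique)
qed

text \<open>Scaling by a positive constant and the embedding of \<open>ennreal\<close> into
  \<open>ereal\<close> are continuous and monotone, hence commute with the liminf.\<close>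

lemma half_sq_integral_liminf:
  "liminf (\<lambda>n. half_sq_integral (M n) (F n))
    = ereal (1/2) * enn2ereal (liminf (\<lambda>n. abs_moment 2 (M n) (F n)))"
  unfolding half_sq_integral_eq
  by (subst Liminf_ereal_mult_left, simp, simp)
    (subst Liminf_compose_continuous_mono[OF continuous_on_enn2ereal], auto simp: mono_def less_eq_ennreal.rep_eq)

lemma half_sq_integral_limsup:
  "limsup (\<lambda>n. half_sq_integral (M n) (F n))
    = ereal (1/2) * enn2ereal (limsup (\<lambda>n. abs_moment 2 (M n) (F n)))"
  unfolding half_sq_integral_eq
  by (subst Limsup_ereal_mult_left, simp, simp)
    (subst Limsup_compose_continuous_mono[OF continuous_on_enn2ereal], auto simp: mono_def less_eq_ennreal.rep_eq)

lemma half_sq_integral_mono: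
  "abs_moment 2 M f \<le> x \<Longrightarrow> half_sq_integral M f \<le> ereal (1/2) * enn2ereal x"
  "x \<le> abs_moment 2 M f \<Longrightarrow> ereal (1/2) * enn2ereal x \<le> half_sq_integral M f"
  unfolding half_sq_integral_eq
  by (auto intro!: ereal_mult_left_mono simp: less_eq_ennreal.rep_eq)

text \<open>\<open>u\<close> converges with exponent \<open>p\<close>, which may be below 2, so the
  differences are compared with exponent 1 only.\<close>

lemma TL_half_sq_integral_liminf:
  assumes u: "TL_converges \<Omega> p (\<lambda>n. (u n, \<mu> n)) (w, \<nu>)"
    and h: "TL_converges \<Omega> 2 (\<lambda>n. (h n, \<mu> n)) (k, \<nu>)" and "1 \<le> p"
  shows "half_sq_integral \<nu> (\<lambda>x. w x - k x) \<le> liminf (\<lambda>n. half_sq_integral (\<mu> n) (\<lambda>x. u n x - h n x))"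
proof -
  obtain \<pi> where seq: "coupling_sequence \<Omega> \<mu> \<nu> \<pi>" and
    lim: "(\<lambda>n. abs_moment 1 (\<pi> n) (\<lambda>z. (u n (fst z) - h n (fst z)) - (w (snd z) - k (snd z)))) \<longlonglongrightarrow> 0"
    using TL_converges_diff[OF u h order_refl \<open>1 \<le> p\<close>] by auto
  have m[measurable]: "u n \<in> borel_measurable (\<mu> n)" "w \<in> borel_measurable \<nu>"
    "h n \<in> borel_measurable (\<mu> n)" "k \<in> borel_measurable \<nu>" for n
    using TL_convergesD(2)[OF u, of n] TL_convergesD(4)[OF u] TL_convergesD(2)[OF h, of n] TL_convergesD(4)[OF h] by (simp_all add: Lp_space_iff)
  show ?thesis
    unfolding half_sq_integral_liminf
    by (intro half_sq_integral_mono coupling_sequence.abs_moment_liminf[OF seq _ _ lim]) measurable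
qed

lemma TL_half_sq_integral_limsup:
  assumes u: "TL_converges \<Omega> 2 (\<lambda>n. (u n, \<mu> n)) (w, \<nu>)"
    and h: "TL_converges \<Omega> 2 (\<lambda>n. (h n, \<mu> n)) (k, \<nu>)"
  shows "limsup (\<lambda>n. half_sq_integral (\<mu> n) (\<lambda>x. u n x - h n x)) \<le> half_sq_integral \<nu> (\<lambda>x. w x - k x)"
proof -
  obtain \<pi> where seq: "coupling_sequence \<Omega> \<mu> \<nu> \<pi>" and
    lim: "(\<lambda>n. abs_moment 2 (\<pi> n) (\<lambda>z. (u n (fst z) - h n (fst z)) - (w (snd z) - k (snd z)))) \<longlonglongrightarrow> 0"
    by (rule TL_converges_diff[OF u h, of 2]) auto
  have m[measurable]: "u n \<in> borel_measurable (\<mu> n)" "w \<in> borel_measurable \<nu>"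
    "h n \<in> borel_measurable (\<mu> n)" "k \<in> borel_measurable \<nu>" for n
    using TL_convergesD(2)[OF u, of n] TL_convergesD(4)[OF u] TL_convergesD(2)[OF h, of n] TL_convergesD(4)[OF h] by (simp_all add: Lp_space_iff)
  show ?thesis
    unfolding half_sq_integral_limsup
    by (intro half_sq_integral_mono coupling_sequence.abs_moment_limsup[OF seq _ _ lim]) measurable
qed

text \<open>Upper semicontinuity bounds the tail by anything above the moment of the limit. Uniform
  bounds on the \<open>h n\<close> are what equicoercivity needs in order to pass from
  \<open>v n - h n\<close> to \<open>v n\<close>.\<close>

lemma TL_convergent_moment_bounded:
  assumes h: "TL_converges \<Omega> 2 (\<lambda>n. (h n, \<mu> n)) (k, \<nu>)"
  shows "\<exists>C\<ge>0. \<forall>n. abs_moment 2 (\<mu> n) (h n) \<le> ennreal C"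
proof -
  obtain \<pi> where seq: "coupling_sequence \<Omega> \<mu> \<nu> \<pi>" and
    lim: "(\<lambda>n. abs_moment 2 (\<pi> n) (\<lambda>z. h n (fst z) - k (snd z))) \<longlonglongrightarrow> 0"
    by (rule TL_converges_imp_coupling_sequence[OF h]) auto
  have D: "h n \<in> borel_measurable (\<mu> n)" "k \<in> borel_measurable \<nu>"
    "abs_moment 2 (\<mu> n) (h n) < \<infinity>" "abs_moment 2 \<nu> k < \<infinity>" for n
    using TL_convergesD(2)[OF h, of n] TL_convergesD(4)[OF h] by (simp_all add: Lp_space_iff)
  obtain B where B: "0 \<le> B" "abs_moment 2 \<nu> k < ennreal B"
  proof (cases "abs_moment 2 \<nu> k")
    case (real r)
    then show ?thesis using that[of "r + 1"] by (simp add: ennreal_less_iff del: ennreal_plus)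
  qed (use D(4) in simp)
  have "limsup (\<lambda>n. abs_moment 2 (\<mu> n) (h n)) < ennreal B"
    by (rule order_le_less_trans[OF coupling_sequence.abs_moment_limsup[OF seq D(1,2) lim] B(2)])
  then have "\<forall>\<^sub>F n in sequentially. abs_moment 2 (\<mu> n) (h n) < ennreal B"
    by (rule Limsup_lessD)
  then obtain N where N: "\<And>n. n \<ge> N \<Longrightarrow> abs_moment 2 (\<mu> n) (h n) < ennreal B"
    by (auto simp: eventually_sequentially)
  \<comment> \<open>Absorbs the finitely many terms before \<open>N\<close>, each of which is
    finite; \<open>enn2real\<close> would turn an infinite one into 0.\<close>
  define S where "S = (\<Sum>i<N. enn2real (abs_moment 2 (\<mu> i) (h i)))"
  have S: "0 \<le> S" by (simp add: S_def sum_nonneg)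
  have "abs_moment 2 (\<mu> n) (h n) \<le> ennreal (B + S)" for n
  proof (cases "n < N")
    case True
    then have "enn2real (abs_moment 2 (\<mu> n) (h n)) \<le> S"
      unfolding S_def by (intro member_le_sum) auto
    then have "ennreal (enn2real (abs_moment 2 (\<mu> n) (h n))) \<le> ennreal (B + S)"
      using B by (intro ennreal_leI) auto
    then show ?thesis using D(3)[of n] by (simp add: ennreal_enn2real_if split: if_splits)
  next
    case False
    then have "abs_moment 2 (\<mu> n) (h n) \<le> ennreal B" using N[of n] by (simp add: less_imp_le)
    also have "\<dots> \<le> ennreal (B + S)" using S by (intro ennreal_leI) auto
    finally show ?thesis .
  qed
  then show ?thesis using B S by (intro exI[of _ "B + S"]) auto
qed

text \<open>
  The approximants are near-minimisers of the transport cost to \<open>w\<close> among all bounded Lipschitz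
  functions, which replaces a diagonal argument.
\<close>

lemma TL_approximation:
  assumes pm: "\<And>n. \<mu> n \<in> prob_moment \<Omega> p" "\<nu> \<in> prob_moment \<Omega> p" and "1 \<le> p"
    and \<pi>: "\<And>n. \<pi> n \<in> couplings (\<mu> n) \<nu>" "(\<lambda>n. abs_moment p (\<pi> n) displacement) \<longlonglongrightarrow> 0"
    and w: "w \<in> Lp_space p \<nu>"
  shows "\<exists>v. (\<forall>n. v n \<in> Lp_space p (\<mu> n)) \<and> TL_converges \<Omega> p (\<lambda>n. (v n, \<mu> n)) (w, \<nu>)"
proof -
  have seq: "coupling_sequence \<Omega> \<mu> \<nu> \<pi>" by (rule coupling_sequenceI[OF pm \<pi>(1)])
  interpret coupling_sequence \<Omega> \<mu> \<nu> \<pi> by fact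
  have p: "0 < p" "0 \<le> p" using \<open>1 \<le> p\<close> by auto
  have [measurable]: "w \<in> borel_measurable \<nu>" and fin: "abs_moment p \<nu> w < \<infinity>"
    using w by (simp_all add: Lp_space_iff)
  have d1: "(\<lambda>n. abs_moment 1 (\<pi> n) displacement) \<longlonglongrightarrow> 0"
    by (rule displacement_tendsto_lower[OF zero_less_one \<open>1 \<le> p\<close> \<pi>(2)])
  define a where "a g n = abs_moment p (\<pi> n) (\<lambda>z. g (fst z) - w (snd z))" for g n
  \<comment> \<open>Each fixed \<open>g\<close> bounds the limsup of \<open>I\<close> by a multiple
    of its moment distance from \<open>w\<close>, and density makes that distance arbitrarily small.
    So \<open>I\<close> tends to 0, with approximants that vary with \<open>n\<close>.\<close>
  define I where "I n = (INF g\<in>bounded_lipschitz. a g n)" for n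
  have I: "I \<longlonglongrightarrow> 0"
  proof (rule ennreal_tendsto_0_leI)
    fix e :: real assume e: "0 < e"
    have "0 < e / 2 powr p" using e by simp
    from bounded_lipschitz_dense[OF prob_space_\<nu> sets_\<nu> _ fin \<open>1 \<le> p\<close> this]
    obtain g where g: "g \<in> bounded_lipschitz" "abs_moment p \<nu> (\<lambda>x. w x - g x) < ennreal (e / 2 powr p)" by auto
    have [measurable]: "g \<in> borel_measurable (\<mu> n)" "g \<in> borel_measurable \<nu>" for n
      by (rule bounded_lipschitz_measurable[OF g(1)])+
    have "I n \<le> ennreal e + ennreal (2 powr p) * abs_moment p (\<pi> n) (\<lambda>z. g (fst z) - g (snd z))" for n
    proof -
      have "I n \<le> a g n" unfolding I_def by (rule INF_lower[OF g(1)])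
      also have "\<dots> \<le> ennreal (2 powr p) * (abs_moment p (\<pi> n) (\<lambda>z. w (snd z) - g (snd z))
          + abs_moment p (\<pi> n) (\<lambda>z. g (fst z) - g (snd z)))"
        unfolding a_def using p by (intro abs_moment_add_le) auto
      also have "abs_moment p (\<pi> n) (\<lambda>z. w (snd z) - g (snd z)) = abs_moment p \<nu> (\<lambda>x. w x - g x)"
        by (rule abs_moment_snd) measurable
      also have "ennreal (2 powr p) * (abs_moment p \<nu> (\<lambda>x. w x - g x) + abs_moment p (\<pi> n) (\<lambda>z. g (fst z) - g (snd z)))
          \<le> ennreal (2 powr p) * (ennreal (e / 2 powr p) + abs_moment p (\<pi> n) (\<lambda>z. g (fst z) - g (snd z)))"
        using g(2) by (intro mult_left_mono add_right_mono) auto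
      also have "\<dots> = ennreal (2 powr p) * ennreal (e / 2 powr p) + ennreal (2 powr p) * abs_moment p (\<pi> n) (\<lambda>z. g (fst z) - g (snd z))"
        by (rule distrib_left)
      also have "ennreal (2 powr p) * ennreal (e / 2 powr p) = ennreal e"
        using e by (simp flip: ennreal_mult)
      finally show ?thesis .
    qed
    moreover have "(\<lambda>n. ennreal (2 powr p) * abs_moment p (\<pi> n) (\<lambda>z. g (fst z) - g (snd z))) \<longlonglongrightarrow> 0"
      by (intro ennreal_cmult_tendsto_0 bounded_lipschitz_tendsto g \<open>1 \<le> p\<close> d1)
    ultimately show "\<exists>g. g \<longlonglongrightarrow> 0 \<and> (\<forall>n. I n \<le> ennreal e + g n)" by blast
  qed
  have "\<exists>g\<in>bounded_lipschitz. a g n \<le> I n + ennreal (1 / real (Suc n))" for n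
  proof -
    \<comment> \<open>The competitor 0 shows that \<open>I n\<close> is finite; only then does
      adding a positive slack give something strictly larger.\<close>
    have "(\<lambda>_. 0) \<in> bounded_lipschitz"
      unfolding bounded_lipschitz_def using lipschitz_on_constant by (auto intro!: exI[of _ 0])
    then have "I n \<le> a (\<lambda>_. 0) n" unfolding I_def by (rule INF_lower)
    also have "a (\<lambda>_. 0) n = abs_moment p (\<pi> n) (\<lambda>z. w (snd z))"
      unfolding a_def by (rule abs_moment_cong) simp
    also have "\<dots> = abs_moment p \<nu> w" by (rule abs_moment_snd) measurable
    finally have "I n < top" using fin by (simp add: order_le_less_trans)
    then have "I n < I n + ennreal (1 / real (Suc n))"
      by (cases "I n") (simp_all add: ennreal_less_iff flip: ennreal_plus)
    then obtain g where "g \<in> bounded_lipschitz" "a g n < I n + ennreal (1 / real (Suc n))"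
      unfolding I_def INF_less_iff by blast
    then show ?thesis using less_imp_le by blast
  qed
  then have "\<forall>n. \<exists>g. g \<in> bounded_lipschitz \<and> a g n \<le> I n + ennreal (1 / real (Suc n))" by blast
  then obtain v where v: "\<And>n. v n \<in> bounded_lipschitz" "\<And>n. a (v n) n \<le> I n + ennreal (1 / real (Suc n))"
    unfolding choice_iff by blast
  have Lp: "v n \<in> Lp_space p (\<mu> n)" for n
  proof -
    obtain B where "\<And>x. \<bar>v n x\<bar> \<le> B" using v(1)[of n] by (auto simp: bounded_lipschitz_def)
    then show ?thesis
      by (rule Lp_space_bounded[OF prob_momentD(1)[OF pm(1)] bounded_lipschitz_measurable(1)[OF v(1)] _ p(2)])
  qed
  have "(\<lambda>n. ennreal (1 / real (Suc n))) \<longlonglongrightarrow> 0"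
    using LIMSEQ_Suc[OF lim_1_over_n[where 'a=real]] by (subst ennreal_tendsto_0_iff) auto
  from tendsto_add[OF I this] have "(\<lambda>n. I n + ennreal (1 / real (Suc n))) \<longlonglongrightarrow> 0" by simp
  then have "(\<lambda>n. a (v n) n) \<longlonglongrightarrow> 0"
    by (rule tendsto_sandwich[OF _ _ tendsto_const, rotated 2]) (intro always_eventually allI zero_le v(2))+
  then have "TL_converges \<Omega> p (\<lambda>n. (v n, \<mu> n)) (w, \<nu>)"
    unfolding a_def using pm Lp w by (intro TL_convergesI[OF _ _ p(1) \<pi>(1) _ \<pi>(2)]) (simp_all add: TL_def)
  then show ?thesis using Lp by blast
qed

text \<open>Truncations are bounded, hence lie in every L^q of a probability measure, and they
  approximate in L^p.\<close>

lemma Lp_space_dense: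
  assumes "prob_space \<nu>" "1 \<le> p" "p \<le> q"
  shows "Lp_dense p \<nu> (Lp_space q \<nu>)"
  unfolding Lp_dense_def
proof (intro conjI ballI allI impI)
  show "Lp_space q \<nu> \<subseteq> Lp_space p \<nu>" using assms by (intro Lp_space_mono) auto
  fix u and e :: real assume u: "u \<in> Lp_space p \<nu>" and e: "0 < e"
  have [measurable]: "u \<in> borel_measurable \<nu>" and fin: "abs_moment p \<nu> u < \<infinity>"
    using u by (simp_all add: Lp_space_iff)
  have p: "0 < p" using assms by simp
  \<comment> \<open>The tolerance is a p-th power because \<open>abs_moment\<close> is the p-th
    power of the norm.\<close>
  obtain k :: nat where k: "abs_moment p \<nu> (\<lambda>x. u x - clamp_abs (real k) (u x)) < ennreal (e powr p)"
    using clamp_approx[OF _ fin p, of "e powr p"] e by auto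
  let ?a = "\<lambda>x. clamp_abs (real k) (u x)"
  have "?a \<in> Lp_space q \<nu>"
    using assms by (intro Lp_space_bounded[where B="real k"] abs_clamp_abs) auto
  moreover have "Lp_norm p \<nu> (\<lambda>x. u x - ?a x) < e"
  proof -
    let ?J = "\<integral>x. \<bar>u x - ?a x\<bar> powr p \<partial>\<nu>"
    have "abs_moment p \<nu> (\<lambda>x. u x - ?a x) = ennreal ?J"
      using order_less_trans[OF k ennreal_less_top] by (intro abs_moment_eq_integral) simp_all
    moreover have J: "0 \<le> ?J" by (intro integral_nonneg_AE) auto
    ultimately have "?J < e powr p" using k by (simp add: ennreal_less_iff)
    then have "?J powr (1/p) < (e powr p) powr (1/p)" using J p by (intro powr_less_mono2) auto
    then show ?thesis using e p by (simp add: Lp_norm_def powr_powr)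
  qed
  ultimately show "\<exists>a\<in>Lp_space q \<nu>. Lp_norm p \<nu> (\<lambda>x. u x - a x) < e"
    by (intro bexI[of _ ?a])
qed

section \<open>Gamma-convergence and equicoercivity\<close>

lemma M_functional_Gamma_converges:
  fixes \<mu> :: "enat \<Rightarrow> (real ^ 'd) measure"
  assumes p: "1 \<le> p"
    and pm: "\<And>n. \<mu> n \<in> prob_moment \<Omega> (max 2 p)"
    and W: "(\<lambda>n. wasserstein (max 2 p) (\<mu> (enat n)) (\<mu> \<infinity>)) \<longlonglongrightarrow> 0"
    and nonneg: "\<And>n u. u \<in> borel_measurable (\<mu> n) \<Longrightarrow> 0 \<le> \<Phi> n u"
    and i: "\<And>u. (\<And>n. u n \<in> Lp_space p (\<mu> n)) \<Longrightarrow>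
          TL_converges \<Omega> p (\<lambda>n. (u (enat n), \<mu> (enat n))) (u \<infinity>, \<mu> \<infinity>) \<Longrightarrow>
          liminf (\<lambda>n. \<Phi> (enat n) (u (enat n))) \<ge> \<Phi> \<infinity> (u \<infinity>)"
    and ii: "\<And>w. w \<in> Lp_space (max 2 p) (\<mu> \<infinity>) \<Longrightarrow>
          \<exists>u. (\<forall>n. u n \<in> Lp_space (max 2 p) (\<mu> (enat n))) \<and>
            TL_converges \<Omega> (max 2 p) (\<lambda>n. (u n, \<mu> (enat n))) (w, \<mu> \<infinity>) \<and>
            limsup (\<lambda>n. \<Phi> (enat n) (u n)) \<le> \<Phi> \<infinity> w"
    and h: "TL_converges \<Omega> 2 (\<lambda>n. (h (enat n), \<mu> (enat n))) (h \<infinity>, \<mu> \<infinity>)"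
    and lam: "0 < lam"
  shows "Gamma_converges \<Omega> p \<mu> (\<lambda>n. M_functional (\<mu> n) lam (h n) (\<Phi> n))"
  unfolding Gamma_converges_def
proof (intro conjI allI impI ballI)
  fix v
  assume v: "(\<forall>n. v n \<in> Lp_space p (\<mu> n)) \<and>
    TL_converges \<Omega> p (\<lambda>n. (v (enat n), \<mu> (enat n))) (v \<infinity>, \<mu> \<infinity>)"
  have \<Phi>: "0 \<le> liminf (\<lambda>n. \<Phi> (enat n) (v (enat n)))"
    using v by (intro Liminf_bounded always_eventually allI nonneg) (simp add: Lp_space_iff)
  have "M_functional (\<mu> \<infinity>) lam (h \<infinity>) (\<Phi> \<infinity>) (v \<infinity>)
      \<le> liminf (\<lambda>n. half_sq_integral (\<mu> (enat n)) (\<lambda>x. v (enat n) x - h (enat n) x))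
        + ereal lam * liminf (\<lambda>n. \<Phi> (enat n) (v (enat n)))"
    unfolding M_functional_def using v i[of v] lam
    by (intro add_mono TL_half_sq_integral_liminf[OF _ h p] ereal_mult_left_mono) auto
  also have "\<dots> = liminf (\<lambda>n. half_sq_integral (\<mu> (enat n)) (\<lambda>x. v (enat n) x - h (enat n) x))
        + liminf (\<lambda>n. ereal lam * \<Phi> (enat n) (v (enat n)))"
    using lam by (subst Liminf_ereal_mult_left) auto
  also have "\<dots> \<le> liminf (\<lambda>n. M_functional (\<mu> (enat n)) lam (h (enat n)) (\<Phi> (enat n)) (v (enat n)))"
    unfolding M_functional_def
  \<comment> \<open>In \<open>ereal\<close> the sum of opposite infinities is infinite, which would
    break superadditivity of the liminf; the signs of the two terms exclude that case.\<close>
  proof (rule ereal_liminf_add_mono, rule nonneg_imp_no_opposite_infinities)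
    show "0 \<le> liminf (\<lambda>n. half_sq_integral (\<mu> (enat n)) (\<lambda>x. v (enat n) x - h (enat n) x))"
      by (intro Liminf_bounded always_eventually allI half_sq_integral_nonneg)
    show "0 \<le> liminf (\<lambda>n. ereal lam * \<Phi> (enat n) (v (enat n)))"
      using lam \<Phi> by (subst Liminf_ereal_mult_left) auto
  qed
  finally show "M_functional (\<mu> \<infinity>) lam (h \<infinity>) (\<Phi> \<infinity>) (v \<infinity>)
      \<le> liminf (\<lambda>n. M_functional (\<mu> (enat n)) lam (h (enat n)) (\<Phi> (enat n)) (v (enat n)))" .
next
  fix w assume w: "w \<in> Lp_space p (\<mu> \<infinity>)"
  have [measurable]: "w \<in> borel_measurable (\<mu> \<infinity>)" using w by (simp add: Lp_space_iff)
  have p': "0 < p" "p \<le> max 2 p" "0 < max 2 p" using p by auto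
  show "\<exists>v. (\<forall>n. v n \<in> Lp_space p (\<mu> (enat n))) \<and>
      TL_converges \<Omega> p (\<lambda>n. (v n, \<mu> (enat n))) (w, \<mu> \<infinity>) \<and>
      limsup (\<lambda>n. M_functional (\<mu> (enat n)) lam (h (enat n)) (\<Phi> (enat n)) (v n))
      \<le> M_functional (\<mu> \<infinity>) lam (h \<infinity>) (\<Phi> \<infinity>) w"
  \<comment> \<open>The split is at the quadratic term and not at the whole functional: if only the
    other term is infinite, (ii) still applies. If the quadratic term is infinite, the upper bound
    is trivial and any sequence converging in TL^p will do.\<close>
  proof (cases "half_sq_integral (\<mu> \<infinity>) (\<lambda>x. w x - h \<infinity> x) = \<infinity>")
    case True
    have "M_functional (\<mu> \<infinity>) lam (h \<infinity>) (\<Phi> \<infinity>) w = \<infinity>"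
      using True nonneg[of w \<infinity>] lam unfolding M_functional_def by (simp add: ereal_mult_eq_MInfty)
    moreover
    obtain \<pi> where \<pi>: "\<And>n. \<pi> n \<in> couplings (\<mu> (enat n)) (\<mu> \<infinity>)"
      "(\<lambda>n. abs_moment (max 2 p) (\<pi> n) displacement) \<longlonglongrightarrow> 0"
      using wasserstein_tendsto_0_imp_couplings[OF pm pm p'(3) W] by blast
    have seq: "coupling_sequence \<Omega> (\<lambda>n. \<mu> (enat n)) (\<mu> \<infinity>) \<pi>"
      by (rule coupling_sequenceI[OF pm pm \<pi>(1)])
    have pm': "\<mu> n \<in> prob_moment \<Omega> p" for n
      using prob_moment_mono[OF p'(1,2)] pm[of n] by blast
    have "\<exists>v. (\<forall>n. v n \<in> Lp_space p (\<mu> (enat n))) \<and> TL_converges \<Omega> p (\<lambda>n. (v n, \<mu> (enat n))) (w, \<mu> \<infinity>)"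
      by (rule TL_approximation[OF pm' pm' p \<pi>(1) _ w])
        (rule coupling_sequence.displacement_tendsto_lower[OF seq p'(1,2) \<pi>(2)])
    ultimately show ?thesis by auto
  next
    case False
    have hm: "h \<infinity> \<in> Lp_space 2 (\<mu> \<infinity>)" by (rule TL_convergesD(4)[OF h])
    then have [measurable]: "h \<infinity> \<in> borel_measurable (\<mu> \<infinity>)" and hf: "abs_moment 2 (\<mu> \<infinity>) (h \<infinity>) < \<infinity>"
      by (simp_all add: Lp_space_iff)
    \<comment> \<open>\<open>h \<infinity>\<close> lies in L^2, so a finite L^2 distance puts
      \<open>w\<close> there too; with \<open>w\<close> in L^p this is membership for
      \<open>max 2 p\<close>.\<close>
    have "abs_moment 2 (\<mu> \<infinity>) (\<lambda>x. w x - h \<infinity> x) \<noteq> \<infinity>"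
      using False by (auto simp: half_sq_integral_eq)
    then have d: "abs_moment 2 (\<mu> \<infinity>) (\<lambda>x. w x - h \<infinity> x) < \<infinity>" by (simp add: less_top)
    have "abs_moment 2 (\<mu> \<infinity>) w \<le> ennreal (2 powr 2) *
        (abs_moment 2 (\<mu> \<infinity>) (\<lambda>x. w x - h \<infinity> x) + abs_moment 2 (\<mu> \<infinity>) (h \<infinity>))"
      by (intro abs_moment_add_le) auto
    also have "\<dots> < \<infinity>" using d hf by (simp add: ennreal_mult_less_top)
    finally have "w \<in> Lp_space 2 (\<mu> \<infinity>)" by (simp add: Lp_space_iff)
    then have "w \<in> Lp_space (max 2 p) (\<mu> \<infinity>)" using w by (rule Lp_space_max)
    from ii[OF this] obtain u where u: "\<And>n. u n \<in> Lp_space (max 2 p) (\<mu> (enat n))"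
      "TL_converges \<Omega> (max 2 p) (\<lambda>n. (u n, \<mu> (enat n))) (w, \<mu> \<infinity>)"
      "limsup (\<lambda>n. \<Phi> (enat n) (u n)) \<le> \<Phi> \<infinity> w" by blast
    have up: "TL_converges \<Omega> p (\<lambda>n. (u n, \<mu> (enat n))) (w, \<mu> \<infinity>)"
      by (rule TL_converges_lower[OF u(2) p]) simp
    have u2: "TL_converges \<Omega> 2 (\<lambda>n. (u n, \<mu> (enat n))) (w, \<mu> \<infinity>)"
      by (rule TL_converges_lower[OF u(2)]) simp_all
    \<comment> \<open>Subadditivity of the limsup holds whatever the signs: for opposite infinities
      the right-hand side is infinite.\<close>
    have "limsup (\<lambda>n. M_functional (\<mu> (enat n)) lam (h (enat n)) (\<Phi> (enat n)) (u n))
        \<le> limsup (\<lambda>n. half_sq_integral (\<mu> (enat n)) (\<lambda>x. u n x - h (enat n) x))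
          + limsup (\<lambda>n. ereal lam * \<Phi> (enat n) (u n))"
      unfolding M_functional_def by (rule ereal_limsup_add_mono)
    also have "\<dots> = limsup (\<lambda>n. half_sq_integral (\<mu> (enat n)) (\<lambda>x. u n x - h (enat n) x))
          + ereal lam * limsup (\<lambda>n. \<Phi> (enat n) (u n))"
      using lam by (subst limsup_ereal_mult_left) auto
    also have "\<dots> \<le> M_functional (\<mu> \<infinity>) lam (h \<infinity>) (\<Phi> \<infinity>) w"
      unfolding M_functional_def using u(3) lam
      by (intro add_mono TL_half_sq_integral_limsup[OF u2 h] ereal_mult_left_mono) auto
    finally show ?thesis using up TL_convergesD(2)[OF up] by blast
  qed
qed

text \<open>The growth condition (v) measures the quadratic distance to 0 and not to
  \<open>h n\<close>. Second moments of the \<open>h n\<close> being bounded, changing the reference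
  function costs only a constant.\<close>

lemma M_functional_equicoercive:
  fixes \<mu> :: "enat \<Rightarrow> (real ^ 'd) measure"
  assumes iii: "\<And>x. (\<And>n. x n \<in> Lp_space p (\<mu> (enat n))) \<Longrightarrow>
          (\<exists>C::real. \<forall>n. Lp_norm p (\<mu> (enat n)) (x n) \<le> C) \<Longrightarrow>
          (\<exists>C::real. \<forall>n. \<bar>\<Phi> (enat n) (x n)\<bar> \<le> ereal C) \<Longrightarrow>
          \<exists>w\<in>Lp_space p (\<mu> \<infinity>). \<exists>s. strict_mono s \<and>
            TL_converges \<Omega> p (\<lambda>k. (x (s k), \<mu> (enat (s k)))) (w, \<mu> \<infinity>)"
    and nonneg: "\<And>n u. u \<in> borel_measurable (\<mu> n) \<Longrightarrow> 0 \<le> \<Phi> n u"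
    and f: "filterlim f at_top at_top"
      "\<And>n u. u \<in> Lp_space p (\<mu> (enat n)) \<Longrightarrow>
         ereal (f (Lp_norm p (\<mu> (enat n)) u)) \<le> half_sq_integral (\<mu> (enat n)) u + ereal lam * \<Phi> (enat n) u"
    and h: "TL_converges \<Omega> 2 (\<lambda>n. (h (enat n), \<mu> (enat n))) (h \<infinity>, \<mu> \<infinity>)"
    and lam: "0 < lam"
  shows "equicoercive \<Omega> p \<mu> (\<lambda>n. M_functional (\<mu> n) lam (h n) (\<Phi> n))"
  unfolding equicoercive_def
proof (intro allI impI)
  fix c :: real and v
  assume v: "\<forall>n. v n \<in> Lp_space p (\<mu> (enat n)) \<and>
    M_functional (\<mu> (enat n)) lam (h (enat n)) (\<Phi> (enat n)) (v n) \<le> ereal c"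
  have vm[measurable]: "v n \<in> borel_measurable (\<mu> (enat n))"
    "h (enat n) \<in> borel_measurable (\<mu> (enat n))" for n
    using v TL_convergesD(2)[OF h, of n] by (simp_all add: Lp_space_iff)
  define H where "H n = half_sq_integral (\<mu> (enat n)) (\<lambda>x. v n x - h (enat n) x)" for n
  define L where "L n = ereal lam * \<Phi> (enat n) (v n)" for n
  have pos: "0 \<le> H n" "0 \<le> L n" for n
    using half_sq_integral_nonneg nonneg[OF vm(1)] lam by (simp_all add: H_def L_def)
  have sum: "H n + L n \<le> ereal c" for n
    using v by (simp add: H_def L_def M_functional_def)
  \<comment> \<open>Neither term can compensate for the other, since both are non-negative; each
    inherits the bound on the sum.\<close>
  have Hc: "H n \<le> ereal c" and Lc: "L n \<le> ereal c" for n
    by (rule order_trans[OF add_increasing2[OF pos(2) order_refl] sum]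
        order_trans[OF add_increasing[OF pos(1) order_refl] sum])+
  have "0 \<le> c" using pos(1)[of 0] Hc[of 0] by (metis ereal_less_eq(5) order_trans)
  have \<Phi>c: "\<bar>\<Phi> (enat n) (v n)\<bar> \<le> ereal (c / lam)" for n
    using Lc[of n] nonneg[OF vm(1), of n] lam unfolding L_def
    by (cases "\<Phi> (enat n) (v n)") (auto simp: field_simps)
  obtain C where C: "0 \<le> C" "\<And>n. abs_moment 2 (\<mu> (enat n)) (h (enat n)) \<le> ennreal C"
    using TL_convergent_moment_bounded[OF h] by blast
  \<comment> \<open>The 4 is the factor \<open>2 powr 2\<close> of \<open>abs_moment_add_le\<close>,
    the \<open>2 * c\<close> undoes the 1/2 in \<open>half_sq_integral\<close>, and \<open>C\<close>
    bounds the second moments of the \<open>h (enat n)\<close>.\<close>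
  define B where "B = 4 * (2 * c + C)"
  have B: "0 \<le> B" using C \<open>0 \<le> c\<close> by (simp add: B_def)
  have hv: "half_sq_integral (\<mu> (enat n)) (v n) \<le> ereal (B / 2)" for n
  proof -
    have "abs_moment 2 (\<mu> (enat n)) (v n) \<le> ennreal (2 powr 2) *
        (abs_moment 2 (\<mu> (enat n)) (\<lambda>x. v n x - h (enat n) x) + abs_moment 2 (\<mu> (enat n)) (h (enat n)))"
      by (intro abs_moment_add_le) auto
    also have "\<dots> \<le> ennreal (2 powr 2) * (ennreal (2 * c) + ennreal C)"
      using Hc[of n] C(2)[of n] unfolding H_def half_sq_integral_le_iff[OF \<open>0 \<le> c\<close>]
      by (intro mult_left_mono add_mono) auto
    also have "\<dots> = ennreal (2 powr 2 * (2 * c + C))"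
      using C \<open>0 \<le> c\<close> by (subst ennreal_mult) (auto simp: ennreal_plus)
    also have "2 powr 2 * (2 * c + C) = 2 * (B / 2)" by (simp add: B_def)
    finally show ?thesis using B by (subst half_sq_integral_le_iff) auto
  qed
  \<comment> \<open>\<open>B / 2 + c\<close> bounds the left-hand side of (v) at every
    \<open>v n\<close>, so a norm beyond \<open>R\<close> would contradict (v).\<close>
  have "\<forall>\<^sub>F x in at_top. B / 2 + c < f x" using f(1) by (simp add: filterlim_at_top_dense)
  then obtain R where R: "\<And>x. x \<ge> R \<Longrightarrow> B / 2 + c < f x" by (auto simp: eventually_at_top_linorder)
  have norm: "Lp_norm p (\<mu> (enat n)) (v n) \<le> R" for n
  proof (rule ccontr)
    assume "\<not> Lp_norm p (\<mu> (enat n)) (v n) \<le> R"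
    then have "B / 2 + c < f (Lp_norm p (\<mu> (enat n)) (v n))" by (intro R) simp
    moreover have "ereal (f (Lp_norm p (\<mu> (enat n)) (v n))) \<le> ereal (B / 2) + ereal c"
      by (rule order_trans[OF f(2) add_mono[OF hv Lc[unfolded L_def]]]) (use v in blast)
    ultimately show False by simp
  qed
  show "\<exists>w\<in>Lp_space p (\<mu> \<infinity>). \<exists>s. strict_mono s \<and>
      TL_converges \<Omega> p (\<lambda>k. (v (s k), \<mu> (enat (s k)))) (w, \<mu> \<infinity>)"
    using v norm \<Phi>c by (intro iii) blast+
qed

theorem proposition7p16:
  fixes \<Omega> :: "(real ^ 'd) set"
    and p :: real
    and \<mu> :: "enat \<Rightarrow> (real ^ 'd) measure"
    and \<Phi> :: "enat \<Rightarrow> (real ^ 'd \<Rightarrow> real) \<Rightarrow> ereal"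
  assumes "open \<Omega>"
    and "1 \<le> p"
    and "\<And>n. \<mu> n \<in> prob_moment \<Omega> (max 2 p)"
    and "(\<lambda>n. wasserstein (max 2 p) (\<mu> (enat n)) (\<mu> \<infinity>)) \<longlonglongrightarrow> 0"
    and "\<And>n. ae_functional (\<mu> n) (\<Phi> n)"
    and i: "\<And>u. (\<And>n. u n \<in> Lp_space p (\<mu> n)) \<Longrightarrow>
          TL_converges \<Omega> p (\<lambda>n. (u (enat n), \<mu> (enat n))) (u \<infinity>, \<mu> \<infinity>) \<Longrightarrow>
          liminf (\<lambda>n. \<Phi> (enat n) (u (enat n))) \<ge> \<Phi> \<infinity> (u \<infinity>)"
    and ii: "\<And>w. w \<in> Lp_space (max 2 p) (\<mu> \<infinity>) \<Longrightarrow>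
          \<exists>u. (\<forall>n. u n \<in> Lp_space (max 2 p) (\<mu> (enat n))) \<and>
            TL_converges \<Omega> (max 2 p) (\<lambda>n. (u n, \<mu> (enat n))) (w, \<mu> \<infinity>) \<and>
            limsup (\<lambda>n. \<Phi> (enat n) (u n)) \<le> \<Phi> \<infinity> w"
    and iii: "\<And>x. (\<And>n. x n \<in> Lp_space p (\<mu> (enat n))) \<Longrightarrow>
          (\<exists>C::real. \<forall>n. Lp_norm p (\<mu> (enat n)) (x n) \<le> C) \<Longrightarrow>
          (\<exists>C::real. \<forall>n. \<bar>\<Phi> (enat n) (x n)\<bar> \<le> ereal C) \<Longrightarrow>
          \<exists>w\<in>Lp_space p (\<mu> \<infinity>). \<exists>s. strict_mono s \<and>
            TL_converges \<Omega> p (\<lambda>k. (x (s k), \<mu> (enat (s k)))) (w, \<mu> \<infinity>)"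
    and iv: "\<And>n u. u \<in> borel_measurable (\<mu> n) \<Longrightarrow> 0 \<le> \<Phi> n u"
    and v: "\<And>lam::real. lam > 0 \<Longrightarrow>
          \<exists>f::real \<Rightarrow> real. strict_mono_on {0..} f \<and> f ` {0..} \<subseteq> {0..} \<and> f 0 = 0 \<and>
            filterlim f at_top at_top \<and>
            (\<forall>n. \<forall>u\<in>Lp_space p (\<mu> (enat n)).
               half_sq_integral (\<mu> (enat n)) u + ereal lam * \<Phi> (enat n) u
                 \<ge> ereal (f (Lp_norm p (\<mu> (enat n)) u)))"
  shows "(\<forall>h. (\<forall>n. h n \<in> Lp_space 2 (\<mu> n)) \<and>
            TL_converges \<Omega> 2 (\<lambda>n. (h (enat n), \<mu> (enat n))) (h \<infinity>, \<mu> \<infinity>) \<longrightarrow>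
            (\<forall>lam>0.
               Gamma_converges \<Omega> p \<mu> (\<lambda>n. M_functional (\<mu> n) lam (h n) (\<Phi> n)) \<and>
               equicoercive \<Omega> p \<mu> (\<lambda>n. M_functional (\<mu> n) lam (h n) (\<Phi> n)))) \<and>
         Lp_dense p (\<mu> \<infinity>) (Lp_space (max 2 p) (\<mu> \<infinity>)) \<and>
         (\<forall>lam>0. \<forall>h. h \<infinity> \<in> Lp_space (max 2 p) (\<mu> \<infinity>) \<and>
            (\<forall>n. h (enat n) \<in> Lp_space (max 2 p) (\<mu> (enat n))) \<and>
            TL_converges \<Omega> (max 2 p) (\<lambda>n. (h (enat n), \<mu> (enat n))) (h \<infinity>, \<mu> \<infinity>) \<longrightarrow>
               Gamma_converges \<Omega> p \<mu> (\<lambda>n. M_functional (\<mu> n) lam (h n) (\<Phi> n)) \<and>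
               equicoercive \<Omega> p \<mu> (\<lambda>n. M_functional (\<mu> n) lam (h n) (\<Phi> n)))"
proof -
  have p: "1 \<le> p" by fact
  \<comment> \<open>Only convergence in TL^2 is assumed of \<open>h\<close>, since
    \<open>TL_converges\<close> already contains membership in L^2. The final claim is then the same
    statement after lowering the exponent from \<open>max 2 p\<close> to 2.\<close>
  have both: "Gamma_converges \<Omega> p \<mu> (\<lambda>n. M_functional (\<mu> n) lam (h n) (\<Phi> n)) \<and>
      equicoercive \<Omega> p \<mu> (\<lambda>n. M_functional (\<mu> n) lam (h n) (\<Phi> n))"
    if h: "TL_converges \<Omega> 2 (\<lambda>n. (h (enat n), \<mu> (enat n))) (h \<infinity>, \<mu> \<infinity>)" and lam: "0 < lam" for h lam
  proof
    show "Gamma_converges \<Omega> p \<mu> (\<lambda>n. M_functional (\<mu> n) lam (h n) (\<Phi> n))"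
      by (rule M_functional_Gamma_converges[OF p assms(3,4) iv i ii h lam])
    obtain f where f: "filterlim f at_top at_top" "\<And>n u. u \<in> Lp_space p (\<mu> (enat n)) \<Longrightarrow>
        ereal (f (Lp_norm p (\<mu> (enat n)) u)) \<le> half_sq_integral (\<mu> (enat n)) u + ereal lam * \<Phi> (enat n) u"
      using v[OF lam] by blast
    show "equicoercive \<Omega> p \<mu> (\<lambda>n. M_functional (\<mu> n) lam (h n) (\<Phi> n))"
      by (rule M_functional_equicoercive[OF iii iv f h lam])
  qed
  have lower: "TL_converges \<Omega> 2 (\<lambda>n. (h (enat n), \<mu> (enat n))) (h \<infinity>, \<mu> \<infinity>)"
    if "TL_converges \<Omega> (max 2 p) (\<lambda>n. (h (enat n), \<mu> (enat n))) (h \<infinity>, \<mu> \<infinity>)" for h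
    by (rule TL_converges_lower[OF that]) simp_all
  have "Lp_dense p (\<mu> \<infinity>) (Lp_space (max 2 p) (\<mu> \<infinity>))"
    by (rule Lp_space_dense[OF prob_momentD(1)[OF assms(3)] p]) simp
  then show ?thesis using both lower by blast
qed

end
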